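(* Let $\mathfrak H$ be a finite dimensional (real or complex) Hilbert space, and let $A_1,\dots,A_k$ be linear operators on $\mathfrak H$ with $$\|A_1\|_2+\dots+\|A_k\|_2=\pi .$$ Then the convergence radius of the multiple Baker--Campbell--Hausdorff (Magnus) expansion of $A_1,\dots,A_k$ (i.e. of the power series $\sum_{n\ge1}\mu_n t^n$ in $t$) is greater than $1$. In particular, the expansion $\sum_{n\geq 1}\mu_n$ converges.
   Context: $\|\cdot\|_2$ is the operator norm. For an operator $A$ whose spectrum (taken after complexification in the real case) is disjoint from $(-\infty,0]$, put $\log A=\int_0^1 (A-\mathrm{Id})(\lambda\,\mathrm{Id}+(1-\lambda)A)^{-1}\,d\lambda$. The multiple BCH (Magnus) expansion of $A_1,\dots,A_k$ is the series $\sum_{n\ge 1}\mu_n$, where the operators $\mu_n$ are defined by the power series expansion $$\log\big(\exp(tA_1)\exp(tA_2)\cdots\exp(tA_k)\big)=\sum_{n=1}^\infty \mu_n t^n ,$$ valid for all sufficiently small $|t|$. (It is the Magnus expansion of the measure obtained by concatenating the constant measures $A_i\cdot\text{Lebesgue}$ on consecutive unit intervals.) The convergence radius of the expansion is the convergence radius of the power series $\sum_n\mu_nt^n$ in $t$. *)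

theory Defs
  imports "HOL-Analysis.Analysis"
begin

text \<open>
  Operators on a finite dimensional Hilbert space are elements of the library type of bounded
  linear maps, whose norm is the operator norm. That type carries no algebra structure, so powers,
  exponential and inverse with respect to composition are introduced here.
\<close>

primrec op_power :: "('v::real_normed_vector \<Rightarrow>\<^sub>L 'v) \<Rightarrow> nat \<Rightarrow> ('v \<Rightarrow>\<^sub>L 'v)" where
  "op_power A 0 = id_blinfun"
| "op_power A (Suc n) = A o\<^sub>L op_power A n"

definition op_exp :: "('v::real_normed_vector \<Rightarrow>\<^sub>L 'v) \<Rightarrow> ('v \<Rightarrow>\<^sub>L 'v)" where
  "op_exp A = (\<Sum>n. (1 / fact n) *\<^sub>R op_power A n)"

definition op_inverse :: "('v::real_normed_vector \<Rightarrow>\<^sub>L 'v) \<Rightarrow> ('v \<Rightarrow>\<^sub>L 'v)" where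
  "op_inverse A = (THE B. A o\<^sub>L B = id_blinfun \<and> B o\<^sub>L A = id_blinfun)"

text \<open>
  The logarithm is meaningful only if the spectrum of \<open>A\<close> avoids the half line of nonpositive
  reals, that is, if all the inverses below exist; elsewhere its value is arbitrary. Below it
  is only used near the identity, where this condition holds.
\<close>

definition op_log :: "('v::real_normed_vector \<Rightarrow>\<^sub>L 'v) \<Rightarrow> ('v \<Rightarrow>\<^sub>L 'v)" where
  "op_log A = integral {0..1}
     (\<lambda>l::real. (A - id_blinfun) o\<^sub>L op_inverse (l *\<^sub>R id_blinfun + (1 - l) *\<^sub>R A))"

definition op_prod :: "('v::real_normed_vector \<Rightarrow>\<^sub>L 'v) list \<Rightarrow> ('v \<Rightarrow>\<^sub>L 'v)" where
  "op_prod As = foldr (o\<^sub>L) As id_blinfun"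

text \<open>
  The scalar multiplication is a parameter, so that the same definition serves real spaces
  (with the real scalar multiplication and real \<open>t\<close>) and complex spaces (with complex \<open>t\<close>).
\<close>

definition op_scale ::
  "('k \<Rightarrow> 'v \<Rightarrow> 'v) \<Rightarrow> 'k \<Rightarrow> ('v::real_normed_vector \<Rightarrow>\<^sub>L 'v) \<Rightarrow> ('v \<Rightarrow>\<^sub>L 'v)" where
  "op_scale smul c A = Blinfun (\<lambda>x. smul c (blinfun_apply A x))"

text \<open>
  The expansion only involves indices \<open>n \<ge> 1\<close>; the entry at index \<open>0\<close> is fixed to be
  \<open>0\<close> in order to have a unique sequence.
\<close>

definition bch_coeff ::
  "('k::real_normed_field \<Rightarrow> 'v \<Rightarrow> 'v) \<Rightarrow> ('v::real_normed_vector \<Rightarrow>\<^sub>L 'v) list \<Rightarrow> nat \<Rightarrow> ('v \<Rightarrow>\<^sub>L 'v)"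
where
  "bch_coeff smul As = (THE \<mu>. \<mu> 0 = 0 \<and>
     (\<forall>\<^sub>F t in nhds 0.
        (\<lambda>n. op_scale smul (t ^ Suc n) (\<mu> (Suc n))) sums
          op_log (op_prod (map (\<lambda>A. op_exp (op_scale smul t A)) As))))"

text \<open>
  The library's \<open>conv_radius\<close> is restricted to coefficients in normed division algebras. Its
  defining Cauchy-Hadamard formula depends only on the norms of the coefficients.
\<close>

definition op_conv_radius :: "(nat \<Rightarrow> 'v::real_normed_vector) \<Rightarrow> ereal" where
  "op_conv_radius \<mu> = inverse (limsup (\<lambda>n. ereal (root n (norm (\<mu> n)))))"

text \<open>
  A finite dimensional complex Hilbert space: complex structure and Hermitian inner product
  (linear in the second argument) on the underlying real Euclidean space, which determines the
  norm and the finiteness of the dimension. The zero space is not an instance of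
  \<open>euclidean_space\<close>, but all operators on it have norm \<open>0\<close>.
\<close>

locale complex_hilbert_space = vector_space scaleC
  for scaleC :: "complex \<Rightarrow> 'v::euclidean_space \<Rightarrow> 'v" +
  fixes cinner :: "'v \<Rightarrow> 'v \<Rightarrow> complex"
  assumes scaleC_of_real: "scaleC (complex_of_real r) x = r *\<^sub>R x"
    and cinner_add_right: "cinner x (y + z) = cinner x y + cinner x z"
    and cinner_scaleC_right: "cinner x (scaleC c y) = c * cinner x y"
    and cinner_commute: "cinner y x = cnj (cinner x y)"
    and cinner_self: "cinner x x = complex_of_real ((norm x)\<^sup>2)"

end

theory Submission
  imports Defs "HOL-Complex_Analysis.Complex_Analysis"
begin

text \<open>
  Let \<open>F(t) = exp(t A\<^sub>1) \<cdots> exp(t A\<^sub>k)\<close> and suppose that \<open>F(t) x = - c x\<close> with \<open>c \<ge> 0\<close> and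
  \<open>\<bar>t\<bar> \<le> 1\<close>. The trajectory that leads from \<open>x\<close> to \<open>F(t) x\<close> turns by the angle \<open>\<pi>\<close>, while the factor
  \<open>exp(t A\<^sub>i)\<close> turns a vector by at most \<open>\<bar>t\<bar> \<parallel>A\<^sub>i\<parallel>\<close>, so every factor turns at full speed along one
  great circle. This forces a common eigenvector \<open>v\<close> with \<open>A\<^sub>i v = c \<parallel>A\<^sub>i\<parallel> v\<close> for a single \<open>c\<close> of
  modulus 1. The span of all such vectors and its orthogonal complement are invariant under the
  \<open>A\<^sub>i\<close>. On the span the logarithm is linear in \<open>t\<close>. On the complement no such vector is left, so
  the spectrum of \<open>F(t)\<close> avoids the closed negative half line for \<open>\<bar>t\<bar> \<le> 1\<close> and, by compactness, on
  a larger disc, where the logarithm is holomorphic. Real operators are complexified.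
\<close>

section \<open>The exponential and angles\<close>

text \<open>The common eigenvectors are a genuine obstruction. On a nonzero \<open>v\<close> with
  \<open>A v = c ||A|| v\<close> for every factor, F(t) acts as exp(t c pi), which is -1 at t = i/c,
  so the integral formula for the logarithm breaks down on the circle |t| = 1. The coefficients
  depend only on the germ at 0. Hence F may be replaced by an operator that is the identity in these
  directions, and the linear term t (A_1 + ... + A_k) is added back to its logarithm. The sum agrees
  with log F near 0 but lives on a disc of radius greater than 1.

  Angles are those of the underlying real Euclidean space, where opposite vectors enclose pi; this
  is the origin of the constant. The complement is invariant because a vector at which A attains its
  norm satisfies A^* A v = ||A||^2 v. Finite dimension enters decisively through the compactness of
  the unit sphere, which makes the inequality for the radius strict. As \<open>bch_coeff\<close> is
  a definite description, the series of the continuation has to be identified with it by uniqueness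
  of power series.\<close>

text \<open>A copy of the operators that can be an instance of the class of Banach algebras, for which the
  library has the exponential.\<close>

typedef (overloaded) 'a endo = "UNIV :: ('a::euclidean_space \<Rightarrow>\<^sub>L 'a) set"
  morphisms blinfun_of_endo Endo by auto

setup_lifting type_definition_endo

instantiation endo :: (euclidean_space) real_normed_algebra_1
begin

lift_definition zero_endo :: "'a endo" is 0 .
lift_definition one_endo :: "'a endo" is id_blinfun .
lift_definition plus_endo :: "'a endo \<Rightarrow> 'a endo \<Rightarrow> 'a endo" is "(+)" .
lift_definition minus_endo :: "'a endo \<Rightarrow> 'a endo \<Rightarrow> 'a endo" is "(-)" .
lift_definition uminus_endo :: "'a endo \<Rightarrow> 'a endo" is uminus .
lift_definition times_endo :: "'a endo \<Rightarrow> 'a endo \<Rightarrow> 'a endo" is "(o\<^sub>L)" .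
lift_definition scaleR_endo :: "real \<Rightarrow> 'a endo \<Rightarrow> 'a endo" is scaleR .
lift_definition norm_endo :: "'a endo \<Rightarrow> real" is norm .
definition dist_endo :: "'a endo \<Rightarrow> 'a endo \<Rightarrow> real" where "dist_endo x y = norm (x - y)"
definition sgn_endo :: "'a endo \<Rightarrow> 'a endo" where "sgn_endo x = scaleR (inverse (norm x)) x"
definition uniformity_endo :: "('a endo \<times> 'a endo) filter"
  where "uniformity_endo = (INF e\<in>{0 <..}. principal {(x, y). dist x y < e})"
definition open_endo :: "'a endo set \<Rightarrow> bool"
  where "open_endo U \<longleftrightarrow> (\<forall>x\<in>U. \<forall>\<^sub>F (x', y) in uniformity. x' = x \<longrightarrow> y \<in> U)"

instance
proof
  fix a b c :: "'a endo" and r s :: real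
  show "a * b * c = a * (b * c)" by transfer (simp add: blinfun_eqI)
  show "(a + b) * c = a * c + b * c" "a * (b + c) = a * b + a * c"
    by (transfer, simp add: blinfun.bilinear_simps blinfun_eqI)+
  show "r *\<^sub>R a * b = r *\<^sub>R (a * b)" "a * r *\<^sub>R b = r *\<^sub>R (a * b)"
    by (transfer, simp add: blinfun.bilinear_simps blinfun_eqI)+
  show "1 * a = a" "a * 1 = a" by (transfer, simp add: blinfun_eqI)+
  show "(0::'a endo) \<noteq> 1"
    by transfer (metis id_blinfun.rep_eq norm_blinfun_id norm_zero zero_neq_one)
  show "norm (a * b) \<le> norm a * norm b" by transfer (rule norm_blinfun_compose)
  show "norm (1::'a endo) = 1" by transfer simp
  show "norm (a + b) \<le> norm a + norm b" by transfer (rule norm_triangle_ineq)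
  show "a + b + c = a + (b + c)" by transfer (simp add: add.assoc)
  show "a + b = b + a" by transfer (simp add: add.commute)
  show "0 + a = a" "- a + a = 0" "a - b = a + - b" by (transfer, simp)+
  show "r *\<^sub>R (a + b) = r *\<^sub>R a + r *\<^sub>R b" "(r + s) *\<^sub>R a = r *\<^sub>R a + s *\<^sub>R a"
    by (transfer, simp add: scaleR_add_left scaleR_add_right)+
  show "r *\<^sub>R s *\<^sub>R a = (r * s) *\<^sub>R a" "1 *\<^sub>R a = a" by (transfer, simp)+
  show "(norm a = 0) = (a = 0)" "norm (r *\<^sub>R a) = \<bar>r\<bar> * norm a" by (transfer, simp)+
qed (simp_all add: dist_endo_def sgn_endo_def uniformity_endo_def open_endo_def)

end

lemma bounded_linear_blinfun_of_endo: "bounded_linear blinfun_of_endo"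
  by (rule bounded_linear_intro[where K = 1]) (transfer, simp)+

instance endo :: (euclidean_space) banach
proof
  fix X :: "nat \<Rightarrow> 'a endo"
  assume "Cauchy X"
  then have "Cauchy (\<lambda>n. blinfun_of_endo (X n))"
    by (rule bounded_linear.Cauchy[OF bounded_linear_blinfun_of_endo])
  then obtain L where L: "(\<lambda>n. blinfun_of_endo (X n)) \<longlonglongrightarrow> L"
    using Cauchy_convergent convergent_def by blast
  have "norm (X n - Endo L) = norm (blinfun_of_endo (X n) - L)" for n
    by (simp add: norm_endo.rep_eq minus_endo.rep_eq Endo_inverse)
  then have "X \<longlonglongrightarrow> Endo L"
    using L unfolding LIMSEQ_iff by simp
  then show "convergent X" by (auto simp: convergent_def)
qed

lemma op_power_endo: "op_power A n = blinfun_of_endo (Endo A ^ n)"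
  by (induction n) (simp_all add: one_endo.rep_eq times_endo.rep_eq Endo_inverse)

lemma op_exp_sums: "(\<lambda>n. (1 / fact n) *\<^sub>R op_power A n) sums op_exp (A :: 'a::euclidean_space \<Rightarrow>\<^sub>L 'a)"
  and op_exp_endo: "op_exp A = blinfun_of_endo (exp (Endo A))"
proof -
  have "(\<lambda>n. blinfun_of_endo (Endo A ^ n /\<^sub>R fact n)) sums blinfun_of_endo (exp (Endo A))"
    unfolding exp_def
    by (intro bounded_linear.sums[OF bounded_linear_blinfun_of_endo] summable_sums summable_exp_generic)
  then have *: "(\<lambda>n. (1 / fact n) *\<^sub>R op_power A n) sums blinfun_of_endo (exp (Endo A))"
    by (simp add: op_power_endo scaleR_endo.rep_eq divide_inverse)
  then show "op_exp A = blinfun_of_endo (exp (Endo A))"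
    unfolding op_exp_def by (simp add: sums_iff)
  with * show "(\<lambda>n. (1 / fact n) *\<^sub>R op_power A n) sums op_exp A" by simp
qed

lemma op_exp_apply_sums:
  "(\<lambda>n. (1 / fact n) *\<^sub>R op_power A n x) sums op_exp (A :: 'a::euclidean_space \<Rightarrow>\<^sub>L 'a) x"
  using bounded_linear.sums[OF blinfun.bounded_linear_left op_exp_sums[of A]]
  by (simp add: blinfun.scaleR_left)

lemma norm_op_power: "norm (op_power A n) \<le> norm (A :: 'a::euclidean_space \<Rightarrow>\<^sub>L 'a) ^ n"
  using norm_power_ineq[of "Endo A" n] by (simp add: op_power_endo norm_endo.rep_eq Endo_inverse)

lemma op_exp_zero [simp]: "op_exp (0 :: 'a::euclidean_space \<Rightarrow>\<^sub>L 'a) = id_blinfun"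
  by (simp add: op_exp_endo one_endo.rep_eq flip: zero_endo_def)

lemma op_exp_add:
  "op_exp ((s + t) *\<^sub>R B) = op_exp (s *\<^sub>R B) o\<^sub>L op_exp (t *\<^sub>R (B :: 'a::euclidean_space \<Rightarrow>\<^sub>L 'a))"
proof -
  have *: "Endo (r *\<^sub>R B) = r *\<^sub>R Endo B" for r
    by (simp add: scaleR_endo.abs_eq eq_onp_same_args)
  have "exp ((s + t) *\<^sub>R Endo B) = exp (s *\<^sub>R Endo B) * exp (t *\<^sub>R Endo B)"
    by (simp add: scaleR_add_left exp_add_commuting)
  then show ?thesis by (simp add: op_exp_endo * times_endo.rep_eq)
qed

lemma op_exp_has_vector_derivative:
  fixes B :: "'a::euclidean_space \<Rightarrow>\<^sub>L 'a"
  shows "((\<lambda>s. op_exp (s *\<^sub>R B)) has_vector_derivative (op_exp (s *\<^sub>R B) o\<^sub>L B)) (at s within S)"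
    and "((\<lambda>s. op_exp (s *\<^sub>R B) z) has_vector_derivative (B (op_exp (s *\<^sub>R B) z))) (at s within S)"
proof -
  have *: "Endo (r *\<^sub>R B) = r *\<^sub>R Endo B" for r
    by (simp add: scaleR_endo.abs_eq eq_onp_same_args)
  have "((\<lambda>s. blinfun_of_endo (exp (s *\<^sub>R Endo B))) has_vector_derivative
      blinfun_of_endo (exp (s *\<^sub>R Endo B) * Endo B)) (at s within S)"
    by (intro bounded_linear.has_vector_derivative[OF bounded_linear_blinfun_of_endo]
        exp_scaleR_has_vector_derivative_right)
  then show "((\<lambda>s. op_exp (s *\<^sub>R B)) has_vector_derivative (op_exp (s *\<^sub>R B) o\<^sub>L B)) (at s within S)"
    by (simp add: op_exp_endo * times_endo.rep_eq Endo_inverse)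
  have "((\<lambda>s. blinfun_of_endo (exp (s *\<^sub>R Endo B))) has_vector_derivative
      blinfun_of_endo (Endo B * exp (s *\<^sub>R Endo B))) (at s within S)"
    using bounded_linear.has_vector_derivative[OF bounded_linear_blinfun_of_endo
        exp_scaleR_has_vector_derivative_right[of "Endo B" s S]]
    by (simp add: exp_times_scaleR_commute)
  then have "((\<lambda>s. op_exp (s *\<^sub>R B)) has_vector_derivative (B o\<^sub>L op_exp (s *\<^sub>R B))) (at s within S)"
    by (simp add: op_exp_endo * times_endo.rep_eq Endo_inverse)
  from bounded_linear.has_vector_derivative[OF blinfun.bounded_linear_left this]
  show "((\<lambda>s. op_exp (s *\<^sub>R B) z) has_vector_derivative (B (op_exp (s *\<^sub>R B) z))) (at s within S)"
    by simp
qed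

lemma norm_op_exp_minus_id:
  "norm (op_exp B - id_blinfun) \<le> exp (norm (B :: 'a::euclidean_space \<Rightarrow>\<^sub>L 'a)) - 1"
proof -
  have 1: "(\<lambda>n. (1 / fact (Suc n)) *\<^sub>R op_power B (Suc n)) sums (op_exp B - id_blinfun)"
    using op_exp_sums[of B] by (subst sums_Suc_iff) simp
  have 2: "(\<lambda>n. norm B ^ Suc n / fact (Suc n)) sums (exp (norm B) - 1)"
    using exp_converges[of "norm B"] by (subst sums_Suc_iff) (simp add: divide_inverse mult.commute)
  have "norm ((1 / fact (Suc n)) *\<^sub>R op_power B (Suc n)) \<le> norm B ^ Suc n / fact (Suc n)" for n
    using norm_op_power[of B "Suc n"] by (simp add: divide_right_mono del: op_power.simps power_Suc fact_Suc)
  then show ?thesis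
    using 1 2 norm_suminf_le by (metis (no_types, lifting) sums_iff)
qed

lemma op_exp_inverse: "op_exp B (op_exp (- B) z) = (z :: 'a::euclidean_space)"
  using op_exp_add[of 1 "-1" B] by (metis add.right_inverse blinfun_apply_blinfun_compose id_blinfun.rep_eq id_apply
      op_exp_zero scaleR_one scaleR_minus_left scaleR_zero_left)

lemma op_exp_nonzero: "z \<noteq> 0 \<Longrightarrow> op_exp B z \<noteq> (0 :: 'a::euclidean_space)"
  using op_exp_inverse[of "- B" z] by auto


section \<open>Angles between vectors, and the speed at which an exponential turns a vector\<close>

definition vangle :: "'a::real_inner \<Rightarrow> 'a \<Rightarrow> real"
  where "vangle x y = arccos ((x \<bullet> y) / (norm x * norm y))"

lemma inner_div_norms_bounds:
  fixes x y :: "'a::real_inner"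
  shows "-1 \<le> (x \<bullet> y) / (norm x * norm y)" "(x \<bullet> y) / (norm x * norm y) \<le> 1"
proof -
  have "\<bar>(x \<bullet> y) / (norm x * norm y)\<bar> \<le> 1"
    using Cauchy_Schwarz_ineq2[of x y] by (auto simp: abs_mult divide_le_eq_1)
  then show "-1 \<le> (x \<bullet> y) / (norm x * norm y)" "(x \<bullet> y) / (norm x * norm y) \<le> 1"
    by linarith+
qed

lemma vangle_bounds: "0 \<le> vangle x y" "vangle x y \<le> pi"
  unfolding vangle_def using inner_div_norms_bounds[of x y] by (simp_all add: arccos_lbound arccos_ubound)

text \<open>This holds for zero vectors as well: division by zero gives them the angle pi / 2, and
  both sides vanish. Statements about the angle itself do need nonzero vectors.\<close>

lemma cos_vangle: "x \<bullet> y = norm x * norm y * cos (vangle x y)"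
  unfolding vangle_def using inner_div_norms_bounds[of x y] by (cases "x = 0 \<or> y = 0") auto

lemma vangle_le_iff:
  assumes "0 \<le> \<theta>" "\<theta> \<le> pi" "x \<noteq> 0" "y \<noteq> 0"
  shows "vangle x y \<le> \<theta> \<longleftrightarrow> norm x * norm y * cos \<theta> \<le> x \<bullet> y"
proof -
  have "vangle x y \<le> \<theta> \<longleftrightarrow> cos \<theta> \<le> cos (vangle x y)"
    using assms vangle_bounds[of x y] by (simp add: cos_mono_le_eq)
  then show ?thesis using assms by (simp add: cos_vangle)
qed

lemma vangle_eq_iff:
  assumes "0 \<le> \<theta>" "\<theta> \<le> pi" "x \<noteq> 0" "y \<noteq> 0"
  shows "vangle x y = \<theta> \<longleftrightarrow> x \<bullet> y = norm x * norm y * cos \<theta>"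
proof -
  have "vangle x y = \<theta> \<longleftrightarrow> cos (vangle x y) = cos \<theta>"
    using assms vangle_bounds[of x y] cos_inj_pi by blast
  then show ?thesis using assms by (simp add: cos_vangle)
qed

lemma vangle_self: "x \<noteq> 0 \<Longrightarrow> vangle x x = 0"
  by (simp add: vangle_eq_iff dot_square_norm power2_eq_square)

text \<open>For unit vectors, the components of \<open>u\<close> and \<open>w\<close> orthogonal to
  \<open>v\<close> have lengths sin \<alpha> and sin \<beta>. Cauchy-Schwarz for these components
  bounds \<open>u \<bullet> w\<close> below by cos (\<alpha> + \<beta>).\<close>

lemma vangle_triangle:
  fixes x y z :: "'a::real_inner"
  assumes "x \<noteq> 0" "y \<noteq> 0" "z \<noteq> 0"
  shows "vangle x z \<le> vangle x y + vangle y z"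
proof (cases "vangle x y + vangle y z \<le> pi")
  case False
  then show ?thesis using vangle_bounds(2)[of x z] by linarith
next
  case True
  have unit: "(u - (u \<bullet> v) *\<^sub>R v) \<bullet> (w - (w \<bullet> v) *\<^sub>R v) = u \<bullet> w - (u \<bullet> v) * (w \<bullet> v)"
    if "norm v = 1" for u v w :: 'a
    using that by (simp add: inner_diff_left inner_diff_right dot_square_norm inner_commute)
  define u v w where "u = sgn x" and "v = sgn y" and "w = sgn z"
  define \<alpha> \<beta> where "\<alpha> = vangle x y" and "\<beta> = vangle y z"
  have n: "norm u = 1" "norm v = 1" "norm w = 1" using assms by (simp_all add: u_def v_def w_def norm_sgn)
  have uv: "u \<bullet> v = cos \<alpha>" and wv: "w \<bullet> v = cos \<beta>"
    using assms cos_vangle[of x y] cos_vangle[of y z]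
    by (simp_all add: u_def v_def w_def sgn_div_norm \<alpha>_def \<beta>_def inner_commute field_simps)
  have "0 \<le> sin \<alpha>" "0 \<le> sin \<beta>" unfolding \<alpha>_def \<beta>_def by (simp_all add: sin_ge_zero vangle_bounds)
  moreover have "(norm (u - (u \<bullet> v) *\<^sub>R v))\<^sup>2 = (sin \<alpha>)\<^sup>2" "(norm (w - (w \<bullet> v) *\<^sub>R v))\<^sup>2 = (sin \<beta>)\<^sup>2"
    unfolding dot_square_norm[symmetric] unit[OF n(2)] sin_squared_eq
    by (simp_all add: dot_square_norm n uv wv) (simp_all add: power2_eq_square)
  ultimately have "norm (u - (u \<bullet> v) *\<^sub>R v) = sin \<alpha>" "norm (w - (w \<bullet> v) *\<^sub>R v) = sin \<beta>"
    by (simp_all add: power2_eq_iff_nonneg)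
  then have "- (sin \<alpha> * sin \<beta>) \<le> u \<bullet> w - cos \<alpha> * cos \<beta>"
    using Cauchy_Schwarz_ineq2[of "u - (u \<bullet> v) *\<^sub>R v" "w - (w \<bullet> v) *\<^sub>R v"] unit[OF n(2), of u w]
    by (simp add: uv wv)
  then have "cos (\<alpha> + \<beta>) \<le> u \<bullet> w" by (simp add: cos_add)
  moreover have "x \<bullet> z = norm x * norm z * (u \<bullet> w)"
    using assms by (simp add: u_def w_def sgn_div_norm field_simps)
  ultimately show ?thesis
    using True assms by (subst vangle_le_iff) (auto simp: \<alpha>_def \<beta>_def vangle_bounds add_nonneg_nonneg)
qed

text \<open>Seen from the origin, a ball of radius \<epsilon> |y| around y has half aperture arcsin
  \<epsilon>. Algebraically this is the inequality between arithmetic and geometric mean for |w| and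
  c |y|, where c = cos (arcsin \<epsilon>).\<close>

lemma vangle_le_arcsin:
  assumes "norm (w - y) \<le> \<epsilon> * norm y" "\<epsilon> < 1" "y \<noteq> 0" "w \<noteq> 0"
  shows "vangle y w \<le> arcsin \<epsilon>"
proof -
  have "0 \<le> \<epsilon> * norm y" using assms(1) norm_ge_zero order_trans by blast
  then have \<epsilon>: "0 \<le> \<epsilon>" using assms(3) by (simp add: zero_le_mult_iff)
  define c where "c = sqrt (1 - \<epsilon>\<^sup>2)"
  have c2: "c\<^sup>2 = 1 - \<epsilon>\<^sup>2" unfolding c_def using \<epsilon> assms(2) by (simp add: power_le_one)
  have cos: "cos (arcsin \<epsilon>) = c" using \<epsilon> assms(2) by (simp add: cos_arcsin c_def)
  have "(norm (w - y))\<^sup>2 \<le> (\<epsilon> * norm y)\<^sup>2" using assms(1) by (simp add: power_mono)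
  then have "(norm w)\<^sup>2 + (c * norm y)\<^sup>2 \<le> 2 * (y \<bullet> w)"
    by (simp add: power_mult_distrib c2 dot_norm_neg[of w y] inner_commute algebra_simps)
  moreover have "2 * norm w * (c * norm y) \<le> (norm w)\<^sup>2 + (c * norm y)\<^sup>2"
    by (rule sum_squares_bound)
  ultimately have "norm y * norm w * cos (arcsin \<epsilon>) \<le> y \<bullet> w" by (simp add: cos mult_ac)
  moreover have "0 \<le> arcsin \<epsilon>" "arcsin \<epsilon> \<le> pi" using \<epsilon> assms(2) arcsin_bounded[of \<epsilon>] arcsin_le_mono[of 0 \<epsilon>]
    by auto
  ultimately show ?thesis using assms by (subst vangle_le_iff) auto
qed

text \<open>Split exp B into n equal steps. Each turns a vector by at most arcsin (exp (|B| / n) -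
  1), and n times this bound tends to |B|.\<close>

lemma vangle_op_exp_le:
  fixes B :: "'a::euclidean_space \<Rightarrow>\<^sub>L 'a"
  assumes "z \<noteq> 0"
  shows "vangle z (op_exp B z) \<le> norm B"
proof -
  have step: "vangle z (op_exp (real n *\<^sub>R C) z) \<le> real n * arcsin (exp (norm C) - 1)"
    if "exp (norm C) - 1 < 1" for C :: "'a \<Rightarrow>\<^sub>L 'a" and n
  proof (induction n)
    case 0
    then show ?case using assms by (simp add: vangle_self)
  next
    case (Suc n)
    let ?y = "op_exp (real n *\<^sub>R C) z"
    have y: "?y \<noteq> 0" "op_exp C ?y \<noteq> 0" using assms by (simp_all add: op_exp_nonzero)
    have "norm (op_exp C ?y - ?y) \<le> norm (op_exp C - id_blinfun) * norm ?y"
      using norm_blinfun[of "op_exp C - id_blinfun" ?y] by (simp add: blinfun.diff_left)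
    also have "\<dots> \<le> (exp (norm C) - 1) * norm ?y"
      by (intro mult_right_mono norm_op_exp_minus_id) simp
    finally have "vangle ?y (op_exp C ?y) \<le> arcsin (exp (norm C) - 1)"
      using that y by (intro vangle_le_arcsin)
    moreover have "op_exp (real (Suc n) *\<^sub>R C) z = op_exp C ?y"
      using op_exp_add[of 1 "real n" C] by simp
    ultimately show ?case
      using Suc vangle_triangle[of z ?y "op_exp C ?y"] assms y by (simp add: algebra_simps)
  qed
  \<comment> \<open>The limit of the n-step bound is a derivative at 0, with step width h = 1 /
    n.\<close>
  define f where "f = (\<lambda>h. arcsin (exp (h * norm B) - 1))"
  have "(f has_real_derivative norm B) (at 0)"
    unfolding f_def by (auto intro!: derivative_eq_intros)
  then have "((\<lambda>h. f h / h) \<longlongrightarrow> norm B) (at 0)"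
    by (simp add: has_field_derivative_iff f_def)
  moreover have "filterlim (\<lambda>n. 1 / real (Suc n)) (at 0) sequentially"
    by (intro filterlim_atI LIMSEQ_Suc[OF lim_1_over_n]) simp
  ultimately have lim: "(\<lambda>n. real (Suc n) * f (1 / real (Suc n))) \<longlonglongrightarrow> norm B"
    using filterlim_compose[of "\<lambda>h. f h / h" _ "at 0" "\<lambda>n. 1 / real (Suc n)"] by (fastforce simp: mult.commute)
  have "(\<lambda>n. exp ((1 / real (Suc n)) * norm B) - 1) \<longlonglongrightarrow> exp (0 * norm B) - 1"
    by (intro tendsto_intros LIMSEQ_Suc[OF lim_1_over_n])
  then have "\<forall>\<^sub>F n in sequentially. exp ((1 / real (Suc n)) * norm B) - 1 < 1"
    by (rule order_tendstoD) simp
  then have "\<forall>\<^sub>F n in sequentially. vangle z (op_exp B z) \<le> real (Suc n) * f (1 / real (Suc n))"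
  proof eventually_elim
    case (elim n)
    then show ?case using step[of "(1 / real (Suc n)) *\<^sub>R B" "Suc n"] by (simp add: f_def del: of_nat_Suc)
  qed
  then show ?thesis by (intro tendsto_lowerbound[OF lim]) auto
qed

text \<open>The curve \<open>y\<close> on the right hand side solves y' = B y, so transporting it
  back by exp (- s B) gives a constant. Neither the lengths of \<open>x\<close> and \<open>e\<close>
  nor their inner product matter here.\<close>

lemma op_exp_rotation:
  fixes B :: "'a::euclidean_space \<Rightarrow>\<^sub>L 'a"
  assumes "B x = b *\<^sub>R e" "B e = - b *\<^sub>R x"
  shows "op_exp B x = cos b *\<^sub>R x + sin b *\<^sub>R e"
proof -
  define y where "y s = cos (b * s) *\<^sub>R x + sin (b * s) *\<^sub>R e" for s
  define g where "g s = op_exp (s *\<^sub>R (- B)) (y s)" for s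
  have y': "(y has_vector_derivative B (y s)) (at s)" for s
    unfolding y_def by (auto intro!: derivative_eq_intros simp: assms blinfun.bilinear_simps algebra_simps)
  have "(g has_vector_derivative 0) (at s within UNIV)" for s
    using bounded_bilinear.has_vector_derivative[OF bounded_bilinear_blinfun_apply
        op_exp_has_vector_derivative(1)[of "- B" s UNIV] y'[of s]]
    unfolding g_def by (simp add: blinfun.bilinear_simps)
  then have "g 1 = g 0"
    using has_vector_derivative_zero_constant[of UNIV g] by (metis UNIV_I convex_UNIV)
  then have "op_exp (- B) (y 1) = x" by (simp add: g_def y_def)
  then show ?thesis using op_exp_inverse[of B "y 1"] by (simp add: y_def)
qed


section \<open>The equality case of the angle estimate\<close>

lemma vangle_op_exp_exact:
  fixes B :: "'a::euclidean_space \<Rightarrow>\<^sub>L 'a"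
  assumes "z \<noteq> 0" "vangle z (op_exp B z) = norm B" "0 \<le> s" "s \<le> t" "t \<le> 1"
  shows "vangle (op_exp (s *\<^sub>R B) z) (op_exp (t *\<^sub>R B) z) = (t - s) * norm B"
proof -
  let ?y = "\<lambda>s. op_exp (s *\<^sub>R B) z"
  have nz: "?y s \<noteq> 0" for s using assms(1) by (rule op_exp_nonzero)
  have le: "vangle (?y s) (?y t) \<le> (t - s) * norm B" if "s \<le> t" for s t
    using vangle_op_exp_le[OF nz[of s], of "(t - s) *\<^sub>R B"] op_exp_add[of "t - s" s B] that by simp
  \<comment> \<open>The trajectory is cut at s and t. Each of the three arcs turns by at most its
    duration times |B|; as the whole turns by |B|, every bound is attained.\<close>
  have "norm B \<le> vangle (?y 0) (?y s) + vangle (?y s) (?y t) + vangle (?y t) (?y 1)"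
    using vangle_triangle[of "?y 0" "?y s" "?y 1", OF nz nz nz]
      vangle_triangle[of "?y s" "?y t" "?y 1", OF nz nz nz] assms(2) by simp
  with le[of 0 s] le[of s t] le[of t 1] assms(3-5) show ?thesis by (simp add: algebra_simps)
qed

lemma norm_sq_lincomb:
  fixes u v :: "'a::real_inner"
  shows "(norm (a *\<^sub>R u + b *\<^sub>R v))\<^sup>2 = a\<^sup>2 * (norm u)\<^sup>2 + 2 * a * b * (u \<bullet> v) + b\<^sup>2 * (norm v)\<^sup>2"
  unfolding power2_norm_eq_inner
  by (simp only: inner_add_left inner_add_right inner_scaleR_left inner_scaleR_right inner_commute[of v u]) algebra

text \<open>Compare Gram determinants with z. The one of the difference quotient \<open>w s\<close>
  equals the one of \<open>y s\<close> divided by s squared, hence is given by the sine of the known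
  angle. In the limit the Gram determinant of B z and z is (|B| |z|)^2 |z|^2; since |B z| is at most
  |B| |z|, there is no room for a component of B z along z.\<close>

lemma op_exp_max_speed:
  fixes B :: "'a::euclidean_space \<Rightarrow>\<^sub>L 'a"
  assumes "z \<noteq> 0" "0 < \<delta>"
    and exact: "\<And>s. 0 < s \<Longrightarrow> s < \<delta> \<Longrightarrow> vangle z (op_exp (s *\<^sub>R B) z) = s * norm B"
  shows "norm (B z) = norm B * norm z" "B z \<bullet> z = 0"
proof -
  define y where "y s = op_exp (s *\<^sub>R B) z" for s
  define w where "w s = (1 / s) *\<^sub>R (y s - z)" for s
  have y': "(y has_vector_derivative B z) (at 0 within {0<..})"
    using op_exp_has_vector_derivative(2)[of B z 0 "{0<..}"] by (simp add: y_def[abs_def])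
  then have "((\<lambda>s. (1 / norm (s - 0)) *\<^sub>R (y s - (y 0 + (s - 0) *\<^sub>R B z))) \<longlongrightarrow> 0) (at_right 0)"
    unfolding has_vector_derivative_def has_derivative_within by blast
  moreover have "\<forall>\<^sub>F s in at_right 0. (1 / norm (s - 0)) *\<^sub>R (y s - (y 0 + (s - 0) *\<^sub>R B z)) = w s - B z"
    using eventually_at_right_less[of "0::real"]
    by eventually_elim (simp add: w_def y_def algebra_simps)
  ultimately have "((\<lambda>s. w s - B z) \<longlongrightarrow> 0) (at_right 0)"
    by (simp add: tendsto_cong)
  then have w: "(w \<longlongrightarrow> B z) (at_right 0)" by (rule LIM_zero_cancel)
  have y: "(y \<longlongrightarrow> z) (at_right 0)"
    using has_vector_derivative_continuous[OF y'] by (simp add: continuous_within y_def)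
  have "((\<lambda>s. sin (s * norm B)) has_real_derivative norm B) (at 0 within {0<..})"
    by (auto intro!: derivative_eq_intros)
  then have sin: "((\<lambda>s. sin (s * norm B) / s) \<longlongrightarrow> norm B) (at_right 0)"
    by (simp add: has_field_derivative_iff)
  have "\<forall>\<^sub>F s in at_right 0. 0 < s \<and> s < \<delta>"
    using eventually_at_right_real[OF assms(2)] by simp
  then have "\<forall>\<^sub>F s in at_right 0. (norm (w s))\<^sup>2 * (norm z)\<^sup>2 - (w s \<bullet> z)\<^sup>2
      = (norm (y s))\<^sup>2 * (norm z)\<^sup>2 * (sin (s * norm B) / s)\<^sup>2"
  proof eventually_elim
    case (elim s)
    have "z \<bullet> y s = norm z * norm (y s) * cos (s * norm B)"
      using cos_vangle[of z "y s"] exact[of s] elim by (simp add: y_def)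
    then have "(norm (y s))\<^sup>2 * (norm z)\<^sup>2 * (sin (s * norm B))\<^sup>2 = (norm (y s))\<^sup>2 * (norm z)\<^sup>2 - (y s \<bullet> z)\<^sup>2"
      by (simp add: sin_squared_eq inner_commute power_mult_distrib algebra_simps)
    also have "\<dots> = (norm (y s - z))\<^sup>2 * (norm z)\<^sup>2 - ((y s - z) \<bullet> z)\<^sup>2"
      unfolding power2_norm_eq_inner
      by (simp add: inner_diff_left inner_diff_right inner_commute power2_eq_square algebra_simps)
    finally have *: "(norm (y s))\<^sup>2 * (norm z)\<^sup>2 * (sin (s * norm B))\<^sup>2 =
      (norm (y s - z))\<^sup>2 * (norm z)\<^sup>2 - ((y s - z) \<bullet> z)\<^sup>2" .
    have "norm (w s) = norm (y s - z) / s" "w s \<bullet> z = ((y s - z) \<bullet> z) / s"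
      using elim by (simp_all add: w_def del: scaleR_right_diff_distrib)
    then show ?case using * elim by (simp add: power_divide flip: diff_divide_distrib)
  qed
  moreover have "((\<lambda>s. (norm (w s))\<^sup>2 * (norm z)\<^sup>2 - (w s \<bullet> z)\<^sup>2) \<longlongrightarrow>
      (norm (B z))\<^sup>2 * (norm z)\<^sup>2 - (B z \<bullet> z)\<^sup>2) (at_right 0)"
    by (intro tendsto_diff tendsto_mult tendsto_power tendsto_norm tendsto_inner tendsto_const w)
  ultimately have "((\<lambda>s. (norm (y s))\<^sup>2 * (norm z)\<^sup>2 * (sin (s * norm B) / s)\<^sup>2) \<longlongrightarrow>
      (norm (B z))\<^sup>2 * (norm z)\<^sup>2 - (B z \<bullet> z)\<^sup>2) (at_right 0)"
    by (rule Lim_transform_eventually[rotated])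
  moreover have "((\<lambda>s. (norm (y s))\<^sup>2 * (norm z)\<^sup>2 * (sin (s * norm B) / s)\<^sup>2) \<longlongrightarrow>
      (norm z)\<^sup>2 * (norm z)\<^sup>2 * (norm B)\<^sup>2) (at_right 0)"
    by (intro tendsto_mult tendsto_power tendsto_norm tendsto_const y sin)
  ultimately have "(norm (B z))\<^sup>2 * (norm z)\<^sup>2 - (B z \<bullet> z)\<^sup>2 = (norm z)\<^sup>2 * (norm z)\<^sup>2 * (norm B)\<^sup>2"
    by (rule tendsto_unique[OF trivial_limit_at_right_real])
  then have eq: "(norm (B z))\<^sup>2 * (norm z)\<^sup>2 - (B z \<bullet> z)\<^sup>2 = (norm B * norm z)\<^sup>2 * (norm z)\<^sup>2"
    by (simp add: power_mult_distrib mult_ac)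
  have le: "(norm (B z))\<^sup>2 * (norm z)\<^sup>2 \<le> (norm B * norm z)\<^sup>2 * (norm z)\<^sup>2"
    by (intro mult_right_mono power_mono norm_blinfun) simp_all
  with eq have "(B z \<bullet> z)\<^sup>2 \<le> 0" by linarith
  then show 0: "B z \<bullet> z = 0" by simp
  with eq assms(1) have "(norm (B z))\<^sup>2 = (norm B * norm z)\<^sup>2" by simp
  then show "norm (B z) = norm B * norm z" by simp
qed

text \<open>Maximal speed holds along the whole trajectory, so orthogonality of B y and y can be
  differentiated: (B (B z)) \<bullet> z = - |B z|^2. With |B (B z)| at most |B|^2 |z| this is the
  equality case of Cauchy-Schwarz, which fixes B (B z).\<close>

lemma op_exp_max_angle:
  fixes B :: "'a::euclidean_space \<Rightarrow>\<^sub>L 'a"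
  assumes "z \<noteq> 0" "vangle z (op_exp B z) = norm B"
  shows "norm (B z) = norm B * norm z" "B z \<bullet> z = 0" "B (B z) = - ((norm B)\<^sup>2 *\<^sub>R z)"
proof -
  define y where "y s = op_exp (s *\<^sub>R B) z" for s
  have speed: "norm (B (y s)) = norm B * norm (y s) \<and> B (y s) \<bullet> y s = 0" if "0 \<le> s" "s < 1" for s
  proof -
    have "vangle (y s) (op_exp (t *\<^sub>R B) (y s)) = t * norm B" if "0 < t" "t < 1 - s" for t
      using vangle_op_exp_exact[OF assms, of s "t + s"] that \<open>0 \<le> s\<close> op_exp_add[of t s B] by (simp add: y_def)
    moreover have "y s \<noteq> 0" using assms(1) by (simp add: y_def op_exp_nonzero)
    ultimately show ?thesis using op_exp_max_speed[of "y s" "1 - s" B] that by simp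
  qed
  have y0: "y 0 = z" by (simp add: y_def)
  show n: "norm (B z) = norm B * norm z" and o: "B z \<bullet> z = 0" using speed[of 0] by (simp_all add: y0)
  \<comment> \<open>The speed is known only for times in [0, 1), hence a one-sided derivative on a
    closed interval inside it.\<close>
  have y': "(y has_vector_derivative B z) (at 0 within {0..1/2})"
    using op_exp_has_vector_derivative(2)[of B z 0] by (simp add: y_def[abs_def])
  have "((\<lambda>s. B (y s) \<bullet> y s) has_vector_derivative (B z \<bullet> B z + B (B z) \<bullet> z)) (at 0 within {0..1/2})"
    using bounded_bilinear.has_vector_derivative[OF bounded_bilinear_inner
        bounded_linear.has_vector_derivative[OF blinfun.bounded_linear_right y', of B] y']
    by (simp add: y0)
  moreover have "((\<lambda>s. B (y s) \<bullet> y s) has_vector_derivative 0) (at 0 within {0..1/2})"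
    using speed by (intro has_vector_derivative_transform[OF _ _ has_vector_derivative_const[of 0]]) auto
  ultimately have "B z \<bullet> B z + B (B z) \<bullet> z = 0"
    using vector_derivative_unique_within_closed_interval[of 0 "1/2" 0 "\<lambda>s. B (y s) \<bullet> y s"] by simp
  then have i: "B (B z) \<bullet> z = - (norm B * norm z)\<^sup>2" by (simp add: dot_square_norm n)
  have "norm (B (B z)) \<le> norm B * (norm B * norm z)" using norm_blinfun[of B "B z"] by (simp add: n)
  then have "(norm (B (B z)))\<^sup>2 \<le> (norm B * (norm B * norm z))\<^sup>2" by (simp add: power_mono)
  moreover have "(norm (B (B z) + (norm B)\<^sup>2 *\<^sub>R z))\<^sup>2
      = (norm (B (B z)))\<^sup>2 + 2 * (norm B)\<^sup>2 * (B (B z) \<bullet> z) + ((norm B)\<^sup>2)\<^sup>2 * (norm z)\<^sup>2"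
    using norm_sq_lincomb[of 1 "B (B z)"] by simp
  ultimately have "(norm (B (B z) + (norm B)\<^sup>2 *\<^sub>R z))\<^sup>2 \<le> 0"
    by (simp add: i power2_eq_square algebra_simps)
  then show "B (B z) = - ((norm B)\<^sup>2 *\<^sub>R z)" by (simp add: eq_neg_iff_add_eq_0)
qed

lemma op_prod_simps [simp]:
  "op_prod [] = id_blinfun" "op_prod (A # As) = A o\<^sub>L op_prod As"
  by (simp_all add: op_prod_def)

lemma op_prod_exp_nonzero:
  "x \<noteq> 0 \<Longrightarrow> blinfun_apply (op_prod (map op_exp Bs)) x \<noteq> (0 :: 'a::euclidean_space)"
  by (induction Bs) (simp_all add: op_exp_nonzero)

lemma vangle_op_prod_exp_le:
  fixes Bs :: "('a::euclidean_space \<Rightarrow>\<^sub>L 'a) list"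
  assumes "x \<noteq> 0"
  shows "vangle x (op_prod (map op_exp Bs) x) \<le> (\<Sum>B\<leftarrow>Bs. norm B)"
proof (induction Bs)
  case Nil
  then show ?case using assms by (simp add: vangle_self)
next
  case (Cons B Bs)
  let ?z = "op_prod (map op_exp Bs) x"
  have "?z \<noteq> 0" by (rule op_prod_exp_nonzero[OF assms])
  then show ?case
    using Cons vangle_op_exp_le[of ?z B] vangle_triangle[OF assms, of ?z "op_exp B ?z"]
    by (simp add: op_exp_nonzero)
qed

lemma op_prod_exp_rotation:
  fixes Bs :: "('a::euclidean_space \<Rightarrow>\<^sub>L 'a) list"
  assumes "\<And>B. B \<in> set Bs \<Longrightarrow> B x = norm B *\<^sub>R e \<and> B e = - norm B *\<^sub>R x"
  defines "S \<equiv> \<Sum>B\<leftarrow>Bs. norm B"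
  shows "op_prod (map op_exp Bs) x = cos S *\<^sub>R x + sin S *\<^sub>R e"
  using assms(1) unfolding S_def
proof (induction Bs)
  case (Cons B Bs)
  have B: "B x = norm B *\<^sub>R e" "B e = - norm B *\<^sub>R x" using Cons.prems[of B] by simp_all
  have "op_exp B e = cos (norm B) *\<^sub>R e + sin (norm B) *\<^sub>R (- x)"
    using B by (intro op_exp_rotation) (simp_all add: blinfun.bilinear_simps)
  then have Be: "op_exp B e = cos (norm B) *\<^sub>R e - sin (norm B) *\<^sub>R x" by simp
  show ?case
    using Cons op_exp_rotation[OF B]
    by (simp add: Be blinfun.bilinear_simps cos_add sin_add algebra_simps)
qed simp

text \<open>Equality in the triangle inequality passes to the tail of the list and to its head. The
  tail moves x along the circle through x and e as far as z, and the head moves z in a direction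
  \<tau>. That no angle is lost where the two arcs join forces \<tau> to be the tangent of the same
  circle at z.\<close>

lemma op_prod_exp_max_angle:
  fixes Bs :: "('a::euclidean_space \<Rightarrow>\<^sub>L 'a) list"
  assumes "x \<noteq> 0" "vangle x (op_prod (map op_exp Bs) x) = (\<Sum>B\<leftarrow>Bs. norm B)"
  shows "\<exists>e. \<forall>B\<in>set Bs. blinfun_apply B x = norm B *\<^sub>R e \<and> blinfun_apply B e = - norm B *\<^sub>R x"
  using assms(2)
proof (induction Bs)
  case (Cons B Bs)
  define S b z where "S = (\<Sum>B\<leftarrow>Bs. norm B)" and "b = norm B" and "z = op_prod (map op_exp Bs) x"
  have z: "z \<noteq> 0" "op_exp B z \<noteq> 0" using assms(1) by (simp_all add: z_def op_prod_exp_nonzero op_exp_nonzero)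
  have "S + b \<le> vangle x z + vangle z (op_exp B z)"
    using Cons.prems vangle_triangle[OF assms(1) z] by (simp add: S_def b_def z_def)
  moreover have "vangle x z \<le> S" "vangle z (op_exp B z) \<le> b"
    using vangle_op_prod_exp_le[OF assms(1)] vangle_op_exp_le[OF z(1)] by (simp_all add: S_def b_def z_def)
  ultimately have xz: "vangle x z = S" and zB: "vangle z (op_exp B z) = norm B" by (simp_all add: b_def)
  have xy: "vangle x (op_exp B z) = S + b" using Cons.prems by (simp add: S_def b_def z_def)
  then have Sb: "S + b \<le> pi" using vangle_bounds(2) by metis
  have S0: "0 \<le> S" "0 \<le> b" using xz vangle_bounds(1) by (auto simp: b_def)
  from Cons.IH xz obtain e where e: "\<And>C. C \<in> set Bs \<Longrightarrow> C x = norm C *\<^sub>R e \<and> C e = - norm C *\<^sub>R x"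
    by (auto simp: S_def z_def)
  have zS: "z = cos S *\<^sub>R x + sin S *\<^sub>R e" unfolding z_def S_def using e by (rule op_prod_exp_rotation)
  note max = op_exp_max_angle[OF z(1) zB, folded b_def]
  define \<tau> where "\<tau> = (1 / b) *\<^sub>R B z"
  consider "b = 0" | "b > 0" "S = 0" | "b > 0" "S > 0" using S0 by linarith
  then show ?case
  proof cases
    case 1
    then show ?thesis using e by (auto simp: b_def)
  next
    case 2
    \<comment> \<open>The tail does not move x, so the plane is determined by the head alone and
      \<tau> serves as e.\<close>
    have "C = 0" if "C \<in> set Bs" for C
      using \<open>S = 0\<close> that unfolding S_def by (subst (asm) sum_list_nonneg_eq_0_iff) auto
    moreover have "B x = norm B *\<^sub>R \<tau>" "B \<tau> = - norm B *\<^sub>R x"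
      using 2 max(3) zS by (simp_all add: \<tau>_def b_def blinfun.bilinear_simps power2_eq_square)
    ultimately show ?thesis by (intro exI[of _ \<tau>]) (fastforce simp del: scaleR_minus_left)
  next
    case 3
    have B\<tau>: "B z = b *\<^sub>R \<tau>" "B \<tau> = - b *\<^sub>R z"
      using 3 max(3) by (simp_all add: \<tau>_def blinfun.bilinear_simps power2_eq_square)
    have n\<tau>: "norm \<tau> = norm z" and o\<tau>: "z \<bullet> \<tau> = 0" using 3 max(1,2) by (simp_all add: \<tau>_def inner_commute)
    have "S < pi" using 3 Sb by linarith
    have "b < pi" using 3 Sb by linarith
    have sS: "sin S > 0" and sb: "sin b > 0" using 3 \<open>S < pi\<close> \<open>b < pi\<close> by (auto intro: sin_gt_zero)
    \<comment> \<open>One nonzero factor shows that e has the length of x and is orthogonal to it: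
      its norm bound at x and e compares |x| with |e| both ways, and at x + e and x - e it compares
      the two diagonals.\<close>
    have "\<exists>C\<in>set Bs. C \<noteq> 0"
    proof (rule ccontr)
      assume "\<not> ?thesis"
      then have "map norm Bs = map (\<lambda>_. 0) Bs" by simp
      then have "S = 0" unfolding S_def by (simp only: sum_list_0)
      with 3 show False by simp
    qed
    then obtain C where C: "C \<in> set Bs" "norm C > 0" by auto
    have Cxe: "norm C * norm e \<le> norm C * norm x" "norm C * norm x \<le> norm C * norm e"
      using norm_blinfun[of C x] norm_blinfun[of C e] e[OF C(1)] by simp_all
    then have ne: "norm e = norm x" using C by simp
    have "norm C * norm (e - x) \<le> norm C * norm (x + e)" "norm C * norm (e + x) \<le> norm C * norm (x - e)"
      using norm_blinfun[of C "x + e"] norm_blinfun[of C "x - e"] e[OF C(1)]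
      by (simp_all add: blinfun.bilinear_simps flip: scaleR_add_right scaleR_diff_right)
    then have "norm (x - e) = norm (x + e)" using C by (simp add: norm_minus_commute add.commute)
    then have "(norm (x - e))\<^sup>2 = (norm (x + e))\<^sup>2" by simp
    then have oe: "x \<bullet> e = 0"
      using norm_sq_lincomb[of 1 x 1 e] norm_sq_lincomb[of 1 x "-1" e] by simp
    have "(norm z)\<^sup>2 = (norm x)\<^sup>2 * ((cos S)\<^sup>2 + (sin S)\<^sup>2)"
      unfolding zS norm_sq_lincomb oe ne by algebra
    then have nz: "norm z = norm x" by simp
    have y: "op_exp B z = cos b *\<^sub>R z + sin b *\<^sub>R \<tau>" by (rule op_exp_rotation[OF B\<tau>])
    have "(norm (op_exp B z))\<^sup>2 = (norm z)\<^sup>2 * ((cos b)\<^sup>2 + (sin b)\<^sup>2)"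
      unfolding y norm_sq_lincomb o\<tau> n\<tau> by algebra
    then have ny: "norm (op_exp B z) = norm x" using nz by simp
    \<comment> \<open>The angles S and S + b of z and of its image with x determine the inner
      product of x with \<tau>, because sin b is positive.\<close>
    have "x \<bullet> z = (norm x)\<^sup>2 * cos S" using cos_vangle[of x z] by (simp add: xz nz power2_eq_square)
    moreover have "x \<bullet> op_exp B z = (norm x)\<^sup>2 * cos (S + b)"
      using cos_vangle[of x "op_exp B z"] by (simp add: xy ny power2_eq_square)
    ultimately have "sin b * (x \<bullet> \<tau>) = sin b * (- (norm x)\<^sup>2 * sin S)"
      unfolding y by (simp add: inner_add_right cos_add algebra_simps)
    then have x\<tau>: "x \<bullet> \<tau> = - (norm x)\<^sup>2 * sin S" using sb by (subst (asm) mult_left_cancel) auto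
    have "sin S *\<^sub>R e = z - cos S *\<^sub>R x" by (simp add: zS)
    then have "(sin S *\<^sub>R e) \<bullet> \<tau> = (z - cos S *\<^sub>R x) \<bullet> \<tau>" by simp
    then have "sin S * (e \<bullet> \<tau>) = sin S * ((norm x)\<^sup>2 * cos S)"
      by (simp add: inner_diff_left o\<tau> x\<tau> mult_ac)
    then have e\<tau>: "e \<bullet> \<tau> = (norm x)\<^sup>2 * cos S" using sS by (subst (asm) mult_left_cancel) auto
    \<comment> \<open>\<sigma> is the tangent at z of the circle through x and e. Both \<tau> and
      \<sigma> have length |x| and their inner product is |x|^2, so they coincide.\<close>
    define \<sigma> where "\<sigma> = cos S *\<^sub>R e + (- sin S) *\<^sub>R x"
    have "(norm \<sigma>)\<^sup>2 = (norm x)\<^sup>2 * ((cos S)\<^sup>2 + (sin S)\<^sup>2)"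
      unfolding \<sigma>_def norm_sq_lincomb inner_commute[of e x] oe ne by algebra
    then have "(norm \<sigma>)\<^sup>2 = (norm x)\<^sup>2" by simp
    moreover have "\<tau> \<bullet> \<sigma> = (norm x)\<^sup>2 * ((cos S)\<^sup>2 + (sin S)\<^sup>2)"
      unfolding \<sigma>_def inner_add_right inner_scaleR_right inner_commute[of \<tau>] e\<tau> x\<tau> by algebra
    then have "\<tau> \<bullet> \<sigma> = (norm x)\<^sup>2" by simp
    ultimately have "(norm (\<tau> - \<sigma>))\<^sup>2 = 0"
      using norm_sq_lincomb[of 1 \<tau> "-1" \<sigma>] by (simp add: n\<tau> nz)
    then have \<tau>: "\<tau> = cos S *\<^sub>R e - sin S *\<^sub>R x" by (simp add: \<sigma>_def)
    have one: "((cos S)\<^sup>2) *\<^sub>R u + ((sin S)\<^sup>2) *\<^sub>R u = u" for u :: 'a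
      by (simp flip: scaleR_add_left)
    have x: "x = cos S *\<^sub>R z - sin S *\<^sub>R \<tau>"
      using one[of x] by (simp add: \<tau> zS power2_eq_square algebra_simps)
    have e': "e = sin S *\<^sub>R z + cos S *\<^sub>R \<tau>"
      using one[of e] by (simp add: \<tau> zS power2_eq_square algebra_simps)
    have "B x = b *\<^sub>R e" by (subst x, subst e') (simp add: blinfun.bilinear_simps B\<tau> algebra_simps)
    moreover have "B e = - b *\<^sub>R x" by (subst x, subst e') (simp add: blinfun.bilinear_simps B\<tau> algebra_simps)
    ultimately show ?thesis using e by (auto simp: b_def)
  qed
qed simp

section \<open>Inversion and complex structures\<close>

lemma op_inverse_eqI:
  assumes "A o\<^sub>L B = id_blinfun" "B o\<^sub>L A = id_blinfun"
  shows "op_inverse A = B"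
  unfolding op_inverse_def
proof (rule the_equality)
  fix C assume "A o\<^sub>L C = id_blinfun \<and> C o\<^sub>L A = id_blinfun"
  then have "B x = C x" for x
    using assms by (metis blinfun_apply_blinfun_compose id_blinfun.rep_eq id_apply)
  then show "C = B" by (simp add: blinfun_eqI)
qed (use assms in simp)

text \<open>Injectivity stands for invertibility, to which it is equivalent in finite dimension. In
  this form it can be checked on kernel vectors.\<close>

definition op_injective :: "('a::real_normed_vector \<Rightarrow>\<^sub>L 'a) \<Rightarrow> bool"
  where "op_injective A \<longleftrightarrow> (\<forall>x. A x = 0 \<longrightarrow> x = 0)"

lemma op_inverse_apply:
  fixes A :: "'a::euclidean_space \<Rightarrow>\<^sub>L 'a"
  assumes "op_injective A"
  shows "A (op_inverse A x) = x" "op_inverse A (A x) = x"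
proof -
  have "linear (blinfun_apply A)"
    using blinfun.bounded_linear_right bounded_linear.linear by blast
  moreover have "inj (blinfun_apply A)"
    using assms calculation by (simp add: linear_injective_0 op_injective_def)
  ultimately obtain g where g: "linear g" "\<And>x. g (A x) = x" "\<And>x. A (g x) = x"
    using linear_injective_isomorphism by blast
  define B where "B = Blinfun g"
  have B: "blinfun_apply B = g"
    unfolding B_def using g(1) by (simp add: bounded_linear_Blinfun_apply linear_conv_bounded_linear)
  have "A o\<^sub>L B = id_blinfun" "B o\<^sub>L A = id_blinfun"
    by (simp_all add: blinfun_eqI B g)
  then have "A o\<^sub>L op_inverse A = id_blinfun" "op_inverse A o\<^sub>L A = id_blinfun"
    using op_inverse_eqI by metis+
  then show "A (op_inverse A x) = x" "op_inverse A (A x) = x"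
    by (metis blinfun_apply_blinfun_compose id_blinfun.rep_eq id_apply)+
qed

text \<open>This is the resolvent identity. It yields both the continuity of inversion and the
  derivative of the resolvent.\<close>

lemma op_inverse_diff:
  fixes A B :: "'a::euclidean_space \<Rightarrow>\<^sub>L 'a"
  assumes "op_injective A" "op_injective B"
  shows "op_inverse A x - op_inverse B x = - op_inverse A ((A - B) (op_inverse B x))"
  using op_inverse_apply[OF assms(1)] op_inverse_apply[OF assms(2)] by (simp add: blinfun.bilinear_simps)

text \<open>The resolvent identity bounds the difference by a product that still contains the
  unknown norm of \<open>R s\<close>. Where |G s - G s0| |R s0| is below 1/2, this factor is
  absorbed and is at most 2 |R s0|.\<close>

lemma continuous_on_op_inverse:
  fixes G :: "'t::topological_space \<Rightarrow> 'a::euclidean_space \<Rightarrow>\<^sub>L 'a"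
  assumes "continuous_on S G" "\<And>s. s \<in> S \<Longrightarrow> op_injective (G s)"
  shows "continuous_on S (\<lambda>s. op_inverse (G s))"
  unfolding continuous_on_def
proof
  fix s0 assume s0: "s0 \<in> S"
  define R where "R s = op_inverse (G s)" for s
  have G: "(G \<longlongrightarrow> G s0) (at s0 within S)" using assms(1) s0 by (simp add: continuous_on_def)
  have bound: "norm (R s - R s0) \<le> norm (R s) * norm (G s - G s0) * norm (R s0)" if "s \<in> S" for s
  proof -
    have "R s - R s0 = - (R s o\<^sub>L (G s - G s0) o\<^sub>L R s0)"
      using op_inverse_diff[OF assms(2)[OF that] assms(2)[OF s0]]
      by (intro blinfun_eqI) (simp add: R_def blinfun.bilinear_simps)
    then have "norm (R s - R s0) = norm ((R s o\<^sub>L (G s - G s0)) o\<^sub>L R s0)" by simp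
    also have "\<dots> \<le> norm (R s o\<^sub>L (G s - G s0)) * norm (R s0)" by (rule norm_blinfun_compose)
    also have "\<dots> \<le> norm (R s) * norm (G s - G s0) * norm (R s0)"
      by (intro mult_right_mono norm_blinfun_compose) simp
    finally show ?thesis .
  qed
  have lim: "((\<lambda>s. norm (G s - G s0) * norm (R s0)) \<longlongrightarrow> 0) (at s0 within S)"
    using G by (intro tendsto_mult_left_zero) (simp add: LIM_zero_iff tendsto_norm_zero_iff)
  then have "\<forall>\<^sub>F s in at s0 within S. norm (G s - G s0) * norm (R s0) < 1 / 2"
    by (rule order_tendstoD) simp
  moreover have "\<forall>\<^sub>F s in at s0 within S. s \<in> S" by (simp add: eventually_at_topological) blast
  ultimately have "\<forall>\<^sub>F s in at s0 within S.
      norm (R s - R s0) \<le> 2 * norm (R s0) * (norm (G s - G s0) * norm (R s0))"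
  proof eventually_elim
    case (elim s)
    have le: "norm (R s - R s0) \<le> norm (R s) * (norm (G s - G s0) * norm (R s0))"
      using bound[OF elim(2)] by (simp add: mult.assoc)
    also have "\<dots> \<le> norm (R s) * (1 / 2)" using elim(1) by (intro mult_left_mono) auto
    finally have "norm (R s) \<le> 2 * norm (R s0)"
      using norm_triangle_sub[of "R s" "R s0"] by simp
    then show ?case using le by (meson mult_right_mono norm_ge_zero mult_nonneg_nonneg order_trans)
  qed
  moreover have "((\<lambda>s. 2 * norm (R s0) * (norm (G s - G s0) * norm (R s0))) \<longlongrightarrow> 0) (at s0 within S)"
    using lim by (rule tendsto_mult_right_zero)
  ultimately have "((\<lambda>s. R s - R s0) \<longlongrightarrow> 0) (at s0 within S)"
    by (rule Lim_null_comparison)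
  then show "((\<lambda>s. op_inverse (G s)) \<longlongrightarrow> op_inverse (G s0)) (at s0 within S)"
    unfolding R_def by (rule LIM_zero_cancel)
qed

context complex_hilbert_space
begin

lemma cinner_add_left: "cinner (x + y) z = cinner x z + cinner y z"
  by (metis cinner_add_right cinner_commute complex_cnj_add)

lemma cinner_scaleC_left: "cinner (scaleC c x) y = cnj c * cinner x y"
  by (metis cinner_commute cinner_scaleC_right complex_cnj_mult)

text \<open>Polarization: the Hermitian form is tied to the Euclidean structure only through norms,
  yet this makes the real angles available in the complex setting.\<close>

lemma Re_cinner: "Re (cinner x y) = x \<bullet> y"
proof -
  have "complex_of_real ((norm (x + y))\<^sup>2) = cinner x x + cinner x y + (cnj (cinner x y) + cinner y y)"
    unfolding cinner_self[symmetric] cinner_add_left cinner_add_right cinner_commute[of y x] by simp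
  then have "(norm (x + y))\<^sup>2 = (norm x)\<^sup>2 + 2 * Re (cinner x y) + (norm y)\<^sup>2"
    unfolding cinner_self by (simp add: complex_eq_iff)
  then show ?thesis by (simp add: dot_norm)
qed

lemma cinner_eq: "cinner x y = Complex (x \<bullet> y) (- (x \<bullet> scaleC \<i> y))"
  using Re_cinner[of x y] Re_cinner[of x "scaleC \<i> y"] by (simp add: complex_eq_iff cinner_scaleC_right)

lemma scaleC_eq: "scaleC c x = Re c *\<^sub>R x + Im c *\<^sub>R scaleC \<i> x"
proof -
  have "scaleC c x = scaleC (complex_of_real (Re c) + \<i> * complex_of_real (Im c)) x"
    by (simp add: complex_eq[symmetric])
  also have "\<dots> = scaleC (complex_of_real (Re c)) x + scaleC (complex_of_real (Im c)) (scaleC \<i> x)"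
    by (metis mult.commute scale_left_distrib scale_scale)
  finally show ?thesis unfolding scaleC_of_real .
qed

lemma norm_scaleC: "norm (scaleC c x) = cmod c * norm x"
proof -
  have "complex_of_real ((norm (scaleC c x))\<^sup>2) = (cnj c * c) * complex_of_real ((norm x)\<^sup>2)"
    unfolding cinner_self[symmetric] cinner_scaleC_left cinner_scaleC_right by simp
  also have "\<dots> = complex_of_real ((cmod c * norm x)\<^sup>2)"
    by (simp add: power_mult_distrib complex_norm_square mult.commute del: of_real_power)
  finally have "(norm (scaleC c x))\<^sup>2 = (cmod c * norm x)\<^sup>2" using of_real_eq_iff by blast
  then show ?thesis by simp
qed

lemma bounded_bilinear_scaleC: "bounded_bilinear scaleC"
proof
  show "scaleC (r *\<^sub>R c) x = r *\<^sub>R scaleC c x" for r c x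
    by (metis scaleC_of_real scaleR_conv_of_real scale_scale)
  show "scaleC c (r *\<^sub>R x) = r *\<^sub>R scaleC c x" for r c x
    by (metis scaleC_of_real scale_left_commute)
  show "\<exists>K. \<forall>a b. norm (scaleC a b) \<le> norm a * norm b * K"
    by (intro exI[of _ 1]) (simp add: norm_scaleC)
qed (simp_all add: scale_left_distrib scale_right_distrib)

lemma bounded_linear_cinner: "bounded_linear (cinner e)"
proof -
  have "bounded_linear (\<lambda>y. complex_of_real (e \<bullet> y) - \<i> * complex_of_real (e \<bullet> scaleC \<i> y))"
    by (intro bounded_linear_sub bounded_linear_const_mult
        bounded_linear_compose[OF bounded_linear_of_real]
        bounded_linear_compose[OF bounded_linear_inner_right]
        bounded_bilinear.bounded_linear_right[OF bounded_bilinear_scaleC] bounded_linear_ident)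
  also have "(\<lambda>y. complex_of_real (e \<bullet> y) - \<i> * complex_of_real (e \<bullet> scaleC \<i> y)) = cinner e"
    by (simp add: fun_eq_iff cinner_eq complex_eq_iff)
  finally show ?thesis .
qed

lemmas cinner_simps = cinner_add_right cinner_scaleC_right
  bounded_linear.linear[OF bounded_linear_cinner, THEN linear_diff]
  bounded_linear.linear[OF bounded_linear_cinner, THEN linear_sum]
  bounded_linear.linear[OF bounded_linear_cinner, THEN linear_cmul]
  bounded_linear.linear[OF bounded_linear_cinner, THEN linear_neg]
  bounded_linear.linear[OF bounded_linear_cinner, THEN linear_0]

lemmas scaleC_right_simps =
  bounded_bilinear.scaleR_right[OF bounded_bilinear_scaleC]
  bounded_bilinear.sum_right[OF bounded_bilinear_scaleC]
  bounded_bilinear.diff_right[OF bounded_bilinear_scaleC]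
  bounded_bilinear.add_right[OF bounded_bilinear_scaleC]

text \<open>An orthonormal basis over the reals is a tight frame over the complex numbers, with frame
  constant 2. This makes the choice of a complex orthonormal basis unnecessary.\<close>

lemma tight_frame: "y = (1 / 2) *\<^sub>R (\<Sum>b\<in>Basis. scaleC (cinner b y) b)"
proof -
  have "(\<Sum>b\<in>Basis. scaleC (cinner b y) b)
      = (\<Sum>b\<in>Basis. (y \<bullet> b) *\<^sub>R b - scaleC \<i> ((scaleC \<i> y \<bullet> b) *\<^sub>R b))"
    by (intro sum.cong refl) (subst scaleC_eq, simp add: cinner_eq inner_commute scaleC_right_simps)
  also have "\<dots> = (\<Sum>b\<in>Basis. (y \<bullet> b) *\<^sub>R b) - scaleC \<i> (\<Sum>b\<in>Basis. (scaleC \<i> y \<bullet> b) *\<^sub>R b)"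
    by (simp only: sum_subtractf scaleC_right_simps)
  also have "\<dots> = y - scaleC \<i> (scaleC \<i> y)" by (simp only: euclidean_representation)
  also have "\<dots> = 2 *\<^sub>R y" by (simp add: scaleR_2)
  finally show ?thesis by simp
qed

text \<open>Operators are real linear maps by their type, so only compatibility with complex scalars
  remains to be required.\<close>

definition clin :: "('v \<Rightarrow>\<^sub>L 'v) \<Rightarrow> bool"
  where "clin A \<longleftrightarrow> (\<forall>c x. blinfun_apply A (scaleC c x) = scaleC c (A x))"

lemma clinD: "clin A \<Longrightarrow> blinfun_apply A (scaleC c x) = scaleC c (A x)"
  by (simp add: clin_def)

lemma op_scale_apply: "blinfun_apply (op_scale scaleC c A) x = scaleC c (A x)"
  unfolding op_scale_def
  by (subst bounded_linear_Blinfun_apply)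
    (auto intro: bounded_linear_compose[OF bounded_bilinear.bounded_linear_right[OF bounded_bilinear_scaleC]]
      blinfun.bounded_linear_right)

lemma norm_op_scale: "norm (op_scale scaleC c A) = cmod c * norm A"
proof (cases "c = 0")
  case True
  then have "op_scale scaleC c A = 0" by (intro blinfun_eqI) (simp add: op_scale_apply)
  then show ?thesis using True by simp
next
  case False
  have le: "norm (op_scale scaleC c A) \<le> cmod c * norm A" for c A
    by (rule norm_blinfun_bound)
      (simp_all add: op_scale_apply norm_scaleC mult.assoc mult_left_mono norm_blinfun)
  have "op_scale scaleC (inverse c) (op_scale scaleC c A) = A"
    using False by (intro blinfun_eqI) (simp add: op_scale_apply)
  then have "norm A \<le> cmod (inverse c) * norm (op_scale scaleC c A)" using le by metis
  then have "cmod c * norm A \<le> norm (op_scale scaleC c A)"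
    using False by (simp add: norm_inverse norm_divide field_simps)
  with le show ?thesis using antisym by blast
qed

lemma bounded_linear_op_scale_left: "bounded_linear (\<lambda>c. op_scale scaleC c A)"
  by (rule bounded_linear_intro[where K = "norm A"])
    (auto intro!: blinfun_eqI simp: op_scale_apply blinfun.bilinear_simps norm_op_scale
      bounded_bilinear.scaleR_left[OF bounded_bilinear_scaleC] scale_left_distrib)

lemma clin_closure:
  "clin id_blinfun" "clin A \<Longrightarrow> clin B \<Longrightarrow> clin (A o\<^sub>L B)" "clin A \<Longrightarrow> clin B \<Longrightarrow> clin (A + B)"
  "clin A \<Longrightarrow> clin B \<Longrightarrow> clin (A - B)" "clin A \<Longrightarrow> clin (r *\<^sub>R A)" "clin A \<Longrightarrow> clin (op_scale scaleC c A)"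
  by (auto simp: clin_def blinfun.bilinear_simps scaleC_right_simps op_scale_apply scale_left_commute)

lemma clin_op_inverse: "op_injective A \<Longrightarrow> clin A \<Longrightarrow> clin (op_inverse A)"
  unfolding clin_def by (metis op_inverse_apply)

lemma clin_op_power: "clin A \<Longrightarrow> clin (op_power A n)"
  by (induction n) (simp_all add: clin_closure)

lemma op_power_op_scale: "clin A \<Longrightarrow> op_power (op_scale scaleC t A) n = op_scale scaleC (t ^ n) (op_power A n)"
  by (induction n) (auto intro!: blinfun_eqI simp: op_scale_apply clinD)

lemma clin_op_exp:
  assumes "clin A" shows "clin (op_exp A)"
  unfolding clin_def
proof (intro allI)
  fix c x
  have "(\<lambda>n. scaleC c ((1 / fact n) *\<^sub>R op_power A n x)) sums scaleC c (op_exp A x)"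
    by (intro bounded_linear.sums[OF bounded_bilinear.bounded_linear_right[OF bounded_bilinear_scaleC]] op_exp_apply_sums)
  then show "op_exp A (scaleC c x) = scaleC c (op_exp A x)"
    using op_exp_apply_sums[of A "scaleC c x"] clin_op_power[OF assms]
    by (simp add: clinD scaleC_right_simps sums_unique2)
qed

lemma clin_op_prod: "(\<And>A. A \<in> set As \<Longrightarrow> clin A) \<Longrightarrow> clin (op_prod As)"
  by (induction As) (simp_all add: clin_closure)

text \<open>This plays the role of the matrix product formula; the factor 1/2 comes from the frame
  constant 2.\<close>

lemma cinner_clin: "clin A \<Longrightarrow> cinner e (A y) = (\<Sum>b\<in>Basis. cinner e (A b) * cinner b y) / 2"
  by (subst tight_frame[of y])
    (simp add: blinfun.bilinear_simps blinfun.sum_right clinD cinner_simps scaleR_conv_of_real mult.commute)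

text \<open>Holomorphy is meant weakly, through scalar matrix coefficients, so that scalar complex
  analysis applies. In finite dimension nothing is lost.\<close>

definition op_holomorphic_on :: "(complex \<Rightarrow> 'v \<Rightarrow>\<^sub>L 'v) \<Rightarrow> complex set \<Rightarrow> bool"
  where "op_holomorphic_on F S \<longleftrightarrow> (\<forall>e x. (\<lambda>t. cinner e (F t x)) holomorphic_on S)"

lemma op_holomorphic_onD: "op_holomorphic_on F S \<Longrightarrow> (\<lambda>t. cinner e (F t x)) holomorphic_on S"
  by (simp add: op_holomorphic_on_def)

lemma op_holomorphic_on_compose:
  assumes "op_holomorphic_on F S" "op_holomorphic_on G S" "\<And>t. t \<in> S \<Longrightarrow> clin (F t)"
  shows "op_holomorphic_on (\<lambda>t. F t o\<^sub>L G t) S"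
  unfolding op_holomorphic_on_def
proof (intro allI)
  fix e x
  have "(\<lambda>t. (\<Sum>b\<in>Basis. cinner e (F t b) * cinner b (G t x)) / 2) holomorphic_on S"
    by (intro holomorphic_intros op_holomorphic_onD assms) simp
  then show "(\<lambda>t. cinner e ((F t o\<^sub>L G t) x)) holomorphic_on S"
    by (rule holomorphic_transform) (simp add: cinner_clin[OF assms(3), of _ e "G _ x"])
qed

lemma op_holomorphic_on_continuous:
  assumes "op_holomorphic_on F S"
  shows "continuous_on S F"
proof (rule continuous_on_blinfun_componentwise)
  fix i :: 'v
  have "continuous_on S (\<lambda>t. (1 / 2) *\<^sub>R (\<Sum>b\<in>Basis. scaleC (cinner b (F t i)) b))"
    by (intro continuous_intros bounded_bilinear.continuous_on[OF bounded_bilinear_scaleC]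
        holomorphic_on_imp_continuous_on op_holomorphic_onD assms)
  then show "continuous_on S (\<lambda>t. F t i)" by (simp flip: tight_frame)
qed

lemma op_holomorphic_on_op_exp:
  assumes "clin A"
  shows "op_holomorphic_on (\<lambda>t. op_exp (op_scale scaleC t A)) (ball 0 r)"
  unfolding op_holomorphic_on_def
proof (intro allI power_series_holomorphic)
  fix e x t
  have "(\<lambda>n. cinner e ((1 / fact n) *\<^sub>R op_power (op_scale scaleC t A) n x)) sums
      cinner e (op_exp (op_scale scaleC t A) x)"
    by (intro bounded_linear.sums[OF bounded_linear_cinner] op_exp_apply_sums)
  then show "(\<lambda>n. (cinner e (op_power A n x) / fact n) * (t - 0) ^ n) sums
      cinner e (op_exp (op_scale scaleC t A) x)"
    by (simp add: op_power_op_scale[OF assms] op_scale_apply cinner_simps scaleR_conv_of_real mult_ac)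
qed

lemma op_holomorphic_on_op_prod:
  assumes "\<And>A. A \<in> set As \<Longrightarrow> clin A"
  shows "op_holomorphic_on (\<lambda>t. op_prod (map (\<lambda>A. op_exp (op_scale scaleC t A)) As)) (ball 0 r)"
  using assms
proof (induction As)
  case Nil
  then show ?case by (simp add: op_holomorphic_on_def)
next
  case (Cons A As)
  then show ?case
    by (auto intro!: op_holomorphic_on_compose op_holomorphic_on_op_exp clin_op_exp clin_closure)
qed

end

section \<open>Holomorphy of the logarithm\<close>

definition op_segment :: "real \<Rightarrow> ('a::real_normed_vector \<Rightarrow>\<^sub>L 'a) \<Rightarrow> ('a \<Rightarrow>\<^sub>L 'a)"
  where "op_segment l A = l *\<^sub>R id_blinfun + (1 - l) *\<^sub>R A"

lemma op_segment_apply: "blinfun_apply (op_segment l A) x = l *\<^sub>R x + (1 - l) *\<^sub>R A x"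
  by (simp add: op_segment_def blinfun.bilinear_simps)

text \<open>A vector in the kernel of \<open>op_segment l A\<close> with l < 1 satisfies A x = - (l
  / (1 - l)) x, and these factors run through all nonpositive reals. So the condition says that A
  has no eigenvalue in the closed negative half line.\<close>

definition log_admissible :: "('a::real_normed_vector \<Rightarrow>\<^sub>L 'a) \<Rightarrow> bool"
  where "log_admissible A \<longleftrightarrow> (\<forall>l\<in>{0..1}. op_injective (op_segment l A))"

lemma log_admissibleD: "log_admissible A \<Longrightarrow> 0 \<le> l \<Longrightarrow> l \<le> 1 \<Longrightarrow> op_injective (op_segment l A)"
  by (simp add: log_admissible_def)

lemma op_log_integrable:
  fixes A :: "'a::euclidean_space \<Rightarrow>\<^sub>L 'a"
  assumes "log_admissible A"
  shows "(\<lambda>l. (A - id_blinfun) o\<^sub>L op_inverse (op_segment l A)) integrable_on {0..1}"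
proof (rule integrable_continuous_real)
  show "continuous_on {0..1} (\<lambda>l. (A - id_blinfun) o\<^sub>L op_inverse (op_segment l A))"
    unfolding op_segment_def
    by (intro bounded_bilinear.continuous_on[OF bounded_bilinear_blinfun_compose] continuous_on_op_inverse
        continuous_intros)
      (use log_admissibleD[OF assms] in \<open>simp add: op_segment_def\<close>)
qed

lemma op_log_bounded_linear:
  fixes A :: "'a::euclidean_space \<Rightarrow>\<^sub>L 'a"
  assumes "log_admissible A" "bounded_linear h"
  shows "h (op_log A) = integral {0..1} (\<lambda>l. h ((A - id_blinfun) o\<^sub>L op_inverse (op_segment l A)))"
  using integral_linear[OF op_log_integrable[OF assms(1)] assms(2)]
  by (simp add: op_log_def op_segment_def o_def)

lemma op_log_apply:
  fixes A :: "'a::euclidean_space \<Rightarrow>\<^sub>L 'a"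
  assumes "log_admissible A"
  shows "op_log A x = integral {0..1} (\<lambda>l. (A - id_blinfun) (op_inverse (op_segment l A) x))"
  using op_log_bounded_linear[OF assms blinfun.bounded_linear_left[of x]] by simp

text \<open>A kernel vector x would satisfy |x| \<le> |A - id| |x|.\<close>

lemma log_admissible_near_id:
  fixes A :: "'a::euclidean_space \<Rightarrow>\<^sub>L 'a"
  assumes "norm (A - id_blinfun) < 1"
  shows "log_admissible A"
  unfolding log_admissible_def op_injective_def
proof (intro ballI allI impI)
  fix l :: real and x
  assume l: "l \<in> {0..1}" and "op_segment l A x = 0"
  then have "x = - ((1 - l) *\<^sub>R (A - id_blinfun) x)"
    by (simp add: op_segment_apply blinfun.bilinear_simps algebra_simps)
  then have "norm x = (1 - l) * norm ((A - id_blinfun) x)"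
    using l by (metis (no_types, opaque_lifting) abs_of_nonneg atLeastAtMost_iff diff_ge_0_iff_ge norm_minus_cancel norm_scaleR)
  also have "\<dots> \<le> 1 * (norm (A - id_blinfun) * norm x)"
    using l by (intro mult_mono norm_blinfun) auto
  finally show "x = 0" using assms by (metis mult_1 mult_le_cancel_right not_le norm_le_zero_iff)
qed

lemma op_log_id [simp]: "op_log (id_blinfun :: 'a::euclidean_space \<Rightarrow>\<^sub>L 'a) = 0"
  by (simp add: op_log_def)

context complex_hilbert_space
begin

lemma clin_op_segment: "clin A \<Longrightarrow> clin (op_segment l A)"
  by (simp add: op_segment_def clin_closure)

lemma clin_op_log:
  assumes "log_admissible A" "clin A"
  shows "clin (op_log A)"
  unfolding clin_def
proof (intro allI)
  fix c and x :: 'v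
  let ?f = "\<lambda>l. (A - id_blinfun) o\<^sub>L op_inverse (op_segment l A)"
  have "bounded_linear (\<lambda>T :: 'v \<Rightarrow>\<^sub>L 'v. scaleC c (blinfun_apply T x))"
    by (intro bounded_linear_compose[OF bounded_bilinear.bounded_linear_right[OF bounded_bilinear_scaleC]]
        blinfun.bounded_linear_left)
  from op_log_bounded_linear[OF assms(1) this]
  have "scaleC c (op_log A x) = integral {0..1} (\<lambda>l. scaleC c (?f l x))" .
  also have "\<dots> = integral {0..1} (\<lambda>l. ?f l (scaleC c x))"
  proof (rule integral_cong)
    fix l :: real assume "l \<in> {0..1}"
    then have "clin (?f l)"
      using assms by (intro clin_closure clin_op_inverse clin_op_segment log_admissibleD) auto
    then show "scaleC c (?f l x) = ?f l (scaleC c x)" by (simp only: clinD)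
  qed
  also have "\<dots> = op_log A (scaleC c x)"
    using op_log_bounded_linear[OF assms(1) blinfun.bounded_linear_left] by simp
  finally show "op_log A (scaleC c x) = scaleC c (op_log A x)" by simp
qed

text \<open>The logarithm is differentiated under the integral sign. The derivative of the resolvent
  R is - (1 - l) R H' R, and everything is written in scalar coefficients with respect to the
  frame.\<close>

lemma op_holomorphic_on_op_log:
  assumes holo: "op_holomorphic_on H S" and S: "open S" "convex S"
    and clin: "\<And>t. t \<in> S \<Longrightarrow> clin (H t)" and adm: "\<And>t. t \<in> S \<Longrightarrow> log_admissible (H t)"
  shows "op_holomorphic_on (\<lambda>t. op_log (H t)) S"
  unfolding op_holomorphic_on_def
proof (intro allI)
  fix e x :: 'v
  define R where "R t l = op_inverse (op_segment l (H t))" for t l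
  define h where "h b b' t = cinner b (H t b')" for b b' t
  define \<rho> where "\<rho> e x t l = cinner e (R t l x)" for e x t l
  \<comment> \<open>This is - (1 - l) R H' R in coordinates; each of its two products contributes a
    factor 1/2 from the frame.\<close>
  define \<rho>' where "\<rho>' e x t l = - (1 - complex_of_real l) / 4 *
      (\<Sum>b\<in>Basis. \<Sum>b'\<in>Basis. \<rho> e b t l * deriv (h b b') t * \<rho> b' x t l)" for e x t l
  define f where "f t l = cinner e (((H t - id_blinfun) o\<^sub>L R t l) x)" for t l
  define f' where "f' t l = (\<Sum>b\<in>Basis. deriv (h e b) t * \<rho> b x t l + h e b t * \<rho>' b x t l) / 2 - \<rho>' e x t l"
    for t l
  have inj: "op_injective (op_segment l (H t))" if "t \<in> S" "l \<in> {0..1}" for t l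
    using that adm by (auto intro: log_admissibleD)
  have h: "h b b' holomorphic_on S" for b b'
    unfolding h_def[abs_def] by (rule op_holomorphic_onD[OF holo])
  have contH: "continuous_on S H" by (rule op_holomorphic_on_continuous[OF holo])
  have contR: "continuous_on (S \<times> {0..1}) (\<lambda>(t, l). R t l)"
    unfolding R_def case_prod_unfold op_segment_def
    by (intro continuous_on_op_inverse continuous_intros continuous_on_compose2[OF contH])
      (use inj in \<open>auto simp: op_segment_def\<close>)
  have cont\<rho>: "continuous_on (S \<times> {0..1}) (\<lambda>(t, l). \<rho> e x t l)" for e x
    using contR unfolding \<rho>_def case_prod_unfold
    by (intro bounded_linear.continuous_on[OF bounded_linear_cinner] continuous_intros)
  have cont_fst: "continuous_on (S \<times> {0..1::real}) (\<lambda>p. g (fst p))"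
    if "g holomorphic_on S" for g :: "complex \<Rightarrow> complex"
    by (rule continuous_on_compose2[OF holomorphic_on_imp_continuous_on[OF that]]) (auto intro: continuous_intros)
  have dh: "(h b b' has_field_derivative deriv (h b b') t) (at t)" if "t \<in> S" for b b' t
    using h S(1) that holomorphic_derivI by blast
  have d\<rho>: "((\<lambda>t. \<rho> e x t l) has_field_derivative \<rho>' e x t0 l) (at t0 within S)"
    if t0: "t0 \<in> S" and l: "l \<in> {0..1}" for e x t0 l
  proof -
    \<comment> \<open>The difference quotient is exact, with one resolvent taken at t and the other
      at t0, so only continuity of the resolvent is needed to pass to the limit.\<close>
    have quot: "(\<rho> e x t l - \<rho> e x t0 l) / (t - t0) = - (1 - complex_of_real l) / 4 *
      (\<Sum>b\<in>Basis. \<Sum>b'\<in>Basis. \<rho> e b t l * ((h b b' t - h b b' t0) / (t - t0)) * \<rho> b' x t0 l)" if t: "t \<in> S" for t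
    proof -
      have "R t l x - R t0 l x = - ((1 - l) *\<^sub>R R t l ((H t - H t0) (R t0 l x)))"
        using op_inverse_diff[OF inj[OF t l] inj[OF t0 l], of x]
        by (simp add: R_def op_segment_apply blinfun.bilinear_simps scaleR_diff_right)
      then have "\<rho> e x t l - \<rho> e x t0 l = - (1 - complex_of_real l) * cinner e (R t l ((H t - H t0) (R t0 l x)))"
        unfolding \<rho>_def by (simp add: scaleR_conv_of_real flip: cinner_simps(3)) (simp add: cinner_simps scaleR_conv_of_real left_diff_distrib)
      also have "cinner e (R t l ((H t - H t0) (R t0 l x)))
          = (\<Sum>b\<in>Basis. \<rho> e b t l * cinner b ((H t - H t0) (R t0 l x))) / 2"
        unfolding \<rho>_def R_def
        by (intro cinner_clin clin_op_inverse clin_op_segment inj clin t l)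
      also have "(\<lambda>b. cinner b ((H t - H t0) (R t0 l x)))
          = (\<lambda>b. (\<Sum>b'\<in>Basis. (h b b' t - h b b' t0) * \<rho> b' x t0 l) / 2)"
        unfolding cinner_clin[OF clin_closure(4)[OF clin[OF t] clin[OF t0]], of _ "R t0 l x"]
        by (simp add: \<rho>_def h_def blinfun.diff_left cinner_simps)
      finally show ?thesis
        by (simp add: sum_distrib_left sum_distrib_right sum_divide_distrib mult_ac)
    qed
    have contt: "continuous_on S (\<lambda>t. \<rho> e b t l)" for b
      by (rule continuous_on_compose2[OF cont\<rho>[of e b], of S "\<lambda>t. (t, l)", simplified])
        (use l in \<open>auto intro!: continuous_intros\<close>)
    have "((\<lambda>t. - (1 - complex_of_real l) / 4 *
      (\<Sum>b\<in>Basis. \<Sum>b'\<in>Basis. \<rho> e b t l * ((h b b' t - h b b' t0) / (t - t0)) * \<rho> b' x t0 l))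
      \<longlongrightarrow> \<rho>' e x t0 l) (at t0 within S)"
      unfolding \<rho>'_def
      using contt t0 dh[OF t0]
      by (intro tendsto_mult tendsto_sum tendsto_const)
        (auto simp: continuous_on_def has_field_derivative_iff intro: tendsto_mono[OF at_le])
    then show ?thesis
      unfolding has_field_derivative_iff
      by (rule Lim_transform_eventually)
        (unfold eventually_at_filter, intro always_eventually allI impI, rule quot[symmetric])
  qed
  have f_eq: "f t l = (\<Sum>b\<in>Basis. h e b t * \<rho> b x t l) / 2 - \<rho> e x t l" if "t \<in> S" for t l
    using cinner_clin[OF clin[OF that], of e "R t l x"]
    by (simp add: f_def h_def \<rho>_def blinfun.diff_left cinner_simps)
  have df: "((\<lambda>t. f t l) has_field_derivative f' t0 l) (at t0 within S)" if t0: "t0 \<in> S" and l: "l \<in> {0..1}" for t0 l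
  proof -
    have "((\<lambda>t. (\<Sum>b\<in>Basis. h e b t * \<rho> b x t l) / 2 - \<rho> e x t l) has_field_derivative f' t0 l) (at t0 within S)"
      unfolding f'_def
      by (rule derivative_eq_intros DERIV_sum d\<rho>[OF t0 l] has_field_derivative_at_within[OF dh[OF t0]] refl
        | simp add: sum.distrib add.commute mult.commute)+
    then show ?thesis
      by (rule has_field_derivative_transform_within[OF _ zero_less_one t0]) (simp add: f_eq)
  qed
  have "(\<lambda>t. integral (cbox 0 1) (f t)) holomorphic_on S"
  proof (rule leibniz_rule_holomorphic[OF _ _ _ S(2)])
    show "((\<lambda>t. f t l) has_field_derivative f' t l) (at t within S)" if "t \<in> S" "l \<in> cbox 0 1" for t l
      using df that by simp
    show "f t integrable_on cbox 0 1" if "t \<in> S" for t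
    proof -
      have "bounded_linear (\<lambda>T :: 'v \<Rightarrow>\<^sub>L 'v. cinner e (blinfun_apply T x))"
        by (intro bounded_linear_compose[OF bounded_linear_cinner] blinfun.bounded_linear_left)
      from integrable_linear[OF op_log_integrable[OF adm[OF that]] this]
      show ?thesis by (simp add: f_def[abs_def] R_def o_def)
    qed
    show "continuous_on (S \<times> cbox 0 1) (\<lambda>(t, l). f' t l)"
      using cont\<rho> unfolding f'_def \<rho>'_def case_prod_unfold
      by (auto intro!: continuous_intros cont_fst h holomorphic_deriv[OF _ S(1)])
  qed
  then show "(\<lambda>t. cinner e (op_log (H t) x)) holomorphic_on S"
  proof (rule holomorphic_transform)
    fix t assume "t \<in> S"
    have "bounded_linear (\<lambda>T :: 'v \<Rightarrow>\<^sub>L 'v. cinner e (blinfun_apply T x))"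
      by (intro bounded_linear_compose[OF bounded_linear_cinner] blinfun.bounded_linear_left)
    from op_log_bounded_linear[OF adm[OF \<open>t \<in> S\<close>] this]
    show "integral (cbox 0 1) (f t) = cinner e (op_log (H t) x)"
      by (simp add: f_def[abs_def] R_def)
  qed
qed

end

section \<open>Extremal vectors\<close>

text \<open>This says A^* A v = |A|^2 v, tested against x. At v the nonnegative form |A|^2 |y|^2 -
  |A y|^2 vanishes, so its first variation along x vanishes too.\<close>

lemma norm_attained_inner:
  fixes A :: "'a::euclidean_space \<Rightarrow>\<^sub>L 'a"
  assumes "norm (A v) = norm A * norm v"
  shows "A x \<bullet> A v = (norm A)\<^sup>2 * (x \<bullet> v)"
proof -
  define p q where "p = A x \<bullet> A v - (norm A)\<^sup>2 * (x \<bullet> v)" and "q = (norm A)\<^sup>2 * (norm x)\<^sup>2 - (norm (A x))\<^sup>2"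
  have "(norm (A x))\<^sup>2 \<le> (norm A * norm x)\<^sup>2" by (intro power_mono norm_blinfun) simp
  then have q: "q \<ge> 0" by (simp add: q_def power_mult_distrib)
  have le: "2 * s * p \<le> s\<^sup>2 * q" for s
  proof -
    have "(norm (A (1 *\<^sub>R v + s *\<^sub>R x)))\<^sup>2 \<le> (norm A * norm (1 *\<^sub>R v + s *\<^sub>R x))\<^sup>2"
      by (intro power_mono norm_blinfun) simp
    then show ?thesis
      unfolding blinfun.add_right blinfun.scaleR_right power_mult_distrib norm_sq_lincomb assms
      by (simp add: p_def q_def inner_commute power_mult_distrib algebra_simps)
  qed
  \<comment> \<open>The quadratic inequality holds for all s; s = p / (q + 1) refutes nonzero p, and
    the added 1 keeps the denominator positive when q = 0.\<close>
  have "2 * p\<^sup>2 / (q + 1) \<le> p\<^sup>2 * q / (q + 1)\<^sup>2"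
    using le[of "p / (q + 1)"] by (simp add: power_divide power2_eq_square)
  then have "2 * p\<^sup>2 * (q + 1) \<le> p\<^sup>2 * q"
    using q by (simp add: power2_eq_square divide_simps split: if_splits)
  moreover have "0 \<le> p\<^sup>2 * q" using q by simp
  moreover have "2 * p\<^sup>2 * (q + 1) = 2 * (p\<^sup>2 * q) + 2 * p\<^sup>2" by algebra
  ultimately have "p\<^sup>2 \<le> 0" by linarith
  then show ?thesis by (simp add: p_def)
qed

text \<open>Q is the orthogonal projection onto the span of E. The two hypotheses say that E and its
  orthogonal complement are preserved by each T, which is why Q commutes with T. The last property
  allows operators to be compared on the range of Q by looking at E only.\<close>

lemma invariant_projection:
  fixes E :: "'a::euclidean_space set" and \<T> :: "('a \<Rightarrow>\<^sub>L 'a) set"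
  assumes inv: "\<And>T v. T \<in> \<T> \<Longrightarrow> v \<in> E \<Longrightarrow> T v \<in> E"
    and orth: "\<And>T v x. T \<in> \<T> \<Longrightarrow> v \<in> E \<Longrightarrow> (\<And>w. w \<in> E \<Longrightarrow> x \<bullet> w = 0) \<Longrightarrow> T x \<bullet> v = 0"
  obtains Q :: "'a \<Rightarrow>\<^sub>L 'a" where
    "\<And>T x. T \<in> \<T> \<Longrightarrow> Q (T x) = T (Q x)" "\<And>v. v \<in> E \<Longrightarrow> Q v = v"
    "\<And>(S :: 'a \<Rightarrow>\<^sub>L 'a) (T :: 'a \<Rightarrow>\<^sub>L 'a) x. (\<And>v. v \<in> E \<Longrightarrow> S v = T v) \<Longrightarrow> S (Q x) = T (Q x)"
proof -
  obtain B where B: "B \<subseteq> span E" "pairwise orthogonal B" "\<And>x. x \<in> B \<Longrightarrow> norm x = 1" "independent B" "span B = span E"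
    using orthonormal_basis_subspace[OF subspace_span[of E]] by metis
  have fin: "finite B" using B(4) independent_imp_finite by blast
  define Q where "Q = Blinfun (\<lambda>x. \<Sum>b\<in>B. (x \<bullet> b) *\<^sub>R b)"
  have Q: "blinfun_apply Q x = (\<Sum>b\<in>B. (x \<bullet> b) *\<^sub>R b)" for x
    unfolding Q_def
    by (subst bounded_linear_Blinfun_apply)
      (auto intro!: bounded_linear_sum bounded_linear_scaleR_const bounded_linear_inner_left)
  have inW: "Q x \<in> span E" for x
    unfolding Q using B(1) by (intro span_sum span_scale) auto
  have "(x - Q x) \<bullet> b' = 0" if "b' \<in> B" for x b'
  proof -
    have "Q x \<bullet> b' = (\<Sum>b\<in>B. if b = b' then x \<bullet> b else 0)"
      unfolding Q inner_sum_left
      using B(2,3) that by (intro sum.cong) (auto simp: pairwise_def orthogonal_def dot_square_norm)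
    then show ?thesis using fin that by (simp add: inner_diff_left)
  qed
  then have oW: "(x - Q x) \<bullet> w = 0" if "w \<in> span E" for x w
    using orthogonal_to_span[of w B "x - Q x"] that B(5) by (simp add: orthogonal_def inner_commute)
  have Qid: "Q w = w" if "w \<in> span E" for w
    using oW[of "w - Q w" w] that inW span_diff[of w E "Q w"] by simp
  have Q0: "Q x = 0" if "\<And>w. w \<in> E \<Longrightarrow> x \<bullet> w = 0" for x
  proof -
    have "x \<bullet> Q x = 0"
      using orthogonal_to_span[OF inW[of x], of x] that by (simp add: orthogonal_def)
    then show ?thesis using oW[OF inW[of x], of x] by (simp add: inner_diff_left)
  qed
  show thesis
  proof
    fix T x assume T: "T \<in> \<T>"
    have "T w \<in> span E" if "w \<in> span E" for w
      using that
    proof (induction rule: span_induct_alt)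
      case (step c v w)
      then show ?case
        using inv[OF T] by (simp add: blinfun.bilinear_simps span_add span_scale span_base)
    qed (simp add: span_zero)
    then have "Q (T (Q x)) = T (Q x)" using inW Qid by blast
    moreover have "(x - Q x) \<bullet> w = 0" if "w \<in> E" for w using oW span_base that by blast
    then have "Q (T (x - Q x)) = 0" using orth[OF T] by (intro Q0) auto
    ultimately show "Q (T x) = T (Q x)" by (simp add: blinfun.bilinear_simps)
  next
    show "Q v = v" if "v \<in> E" for v using Qid span_base that by blast
  next
    fix S T :: "'a \<Rightarrow>\<^sub>L 'a" and x assume ST: "\<And>v. v \<in> E \<Longrightarrow> S v = T v"
    from inW[of x] show "S (Q x) = T (Q x)"
      by (induction rule: span_induct_alt) (simp_all add: ST blinfun.bilinear_simps)
  qed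
qed

text \<open>The inadmissible parameters in the disc of radius 2 form a compact set \<open>Z\<close>.
  It misses the closed unit disc, so its least modulus exceeds 1.\<close>

lemma log_admissible_enlarge_disc:
  fixes H :: "complex \<Rightarrow> 'a::euclidean_space \<Rightarrow>\<^sub>L 'a"
  assumes cont: "continuous_on (cball 0 2) H"
    and adm: "\<And>t. cmod t \<le> 1 \<Longrightarrow> log_admissible (H t)"
  obtains r where "1 < r" "\<And>t. cmod t < r \<Longrightarrow> log_admissible (H t)"
proof -
  \<comment> \<open>Kernel vectors are normalized to the compact unit sphere, so that
    \<open>Z\<close> is the projection of a compact set.\<close>
  define K :: "(complex \<times> real \<times> 'a) set" where "K = cball 0 2 \<times> {0..1} \<times> sphere 0 1"
  define Z where "Z = fst ` {p \<in> K. op_segment (fst (snd p)) (H (fst p)) (snd (snd p)) = 0}"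
  have Z_iff: "t \<in> Z \<longleftrightarrow> \<not> log_admissible (H t)" if "t \<in> cball 0 2" for t
  proof -
    have "t \<in> Z \<longleftrightarrow> (\<exists>l\<in>{0..1}. \<exists>x\<in>sphere 0 1. op_segment l (H t) x = 0)"
      using that by (force simp: Z_def K_def)
    also have "\<dots> \<longleftrightarrow> (\<exists>l\<in>{0..1}. \<exists>x. op_segment l (H t) x = 0 \<and> x \<noteq> 0)"
    proof (intro bex_cong refl iffI)
      fix l assume "\<exists>x. op_segment l (H t) x = 0 \<and> x \<noteq> 0"
      then obtain x where "op_segment l (H t) x = 0" "x \<noteq> 0" by blast
      then show "\<exists>x\<in>sphere 0 1. op_segment l (H t) x = 0"
        by (intro bexI[of _ "sgn x"]) (simp_all add: sgn_div_norm blinfun.bilinear_simps)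
    qed auto
    finally show ?thesis by (auto simp: log_admissible_def op_injective_def)
  qed
  have "closed {p \<in> K. op_segment (fst (snd p)) (H (fst p)) (snd (snd p)) = 0}"
  proof (rule continuous_closed_preimage_constant)
    show "continuous_on K (\<lambda>p. op_segment (fst (snd p)) (H (fst p)) (snd (snd p)))"
      unfolding op_segment_apply
      by (intro continuous_intros continuous_on_compose2[OF cont]) (auto simp: K_def)
  qed (auto simp: K_def intro!: closed_Times)
  moreover have "compact K" by (auto simp: K_def intro!: compact_Times)
  ultimately have "compact {p \<in> K. op_segment (fst (snd p)) (H (fst p)) (snd (snd p)) = 0}"
    using compact_Int_closed[of K] by (metis (no_types, lifting) Int_absorb1 mem_Collect_eq subsetI)
  then have "compact Z" unfolding Z_def by (intro compact_continuous_image continuous_intros)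
  obtain \<rho> where \<rho>: "1 < \<rho>" "\<And>t. t \<in> Z \<Longrightarrow> \<rho> \<le> cmod t"
  proof (cases "Z = {}")
    case True
    then show ?thesis using that[of 2] by simp
  next
    case False
    obtain t0 where t0: "t0 \<in> Z" "\<And>t. t \<in> Z \<Longrightarrow> cmod t0 \<le> cmod t"
      using continuous_attains_inf[OF \<open>compact Z\<close> False, of cmod] by (auto intro: continuous_intros)
    have "t0 \<in> cball 0 2" using t0(1) by (auto simp: Z_def K_def)
    then have "1 < cmod t0" using Z_iff adm t0(1) not_le by blast
    then show ?thesis using t0 that by blast
  qed
  show thesis
  proof
    show "1 < min 2 \<rho>" using \<rho> by simp
    fix t assume "cmod t < min 2 \<rho>"
    then show "log_admissible (H t)" using Z_iff[of t] \<rho>(2)[of t] by auto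
  qed
qed

text \<open>The antiderivative in l is - Ln (l + (1 - l) \<zeta>). The segment from \<zeta> to 1
  stays in the right half plane, away from the branch cut.\<close>

lemma Ln_segment_integral:
  assumes "cmod (\<zeta> - 1) < 1"
  shows "((\<lambda>l. (\<zeta> - 1) / (complex_of_real l + (1 - complex_of_real l) * \<zeta>)) has_integral Ln \<zeta>) {0..1}"
proof -
  define g where "g z = - Ln (z + (1 - z) * \<zeta>)" for z
  have seg: "complex_of_real l + (1 - complex_of_real l) * \<zeta> \<notin> \<real>\<^sub>\<le>\<^sub>0" if "l \<in> {0..1}" for l
  proof -
    have "\<bar>Re \<zeta> - 1\<bar> < 1" using assms abs_Re_le_cmod[of "\<zeta> - 1"] by simp
    then have "0 < Re \<zeta>" by linarith
    then have "0 < l + (1 - l) * Re \<zeta>" using that by (cases "l = 0") (auto intro: add_pos_nonneg)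
    then show ?thesis by (auto simp: complex_nonpos_Reals_iff)
  qed
  have "((\<lambda>l. g (complex_of_real l)) has_vector_derivative
      (\<zeta> - 1) / (complex_of_real l + (1 - complex_of_real l) * \<zeta>)) (at l within {0..1})" if "l \<in> {0..1}" for l
  proof -
    have "(g has_field_derivative (\<zeta> - 1) / (complex_of_real l + (1 - complex_of_real l) * \<zeta>)) (at (complex_of_real l))"
      unfolding g_def using seg[OF that]
      by (auto intro!: derivative_eq_intros simp: divide_inverse algebra_simps)
    then show ?thesis by (intro has_vector_derivative_real_field)
  qed
  from fundamental_theorem_of_calculus[OF _ this, simplified]
  show ?thesis by (simp add: g_def)
qed

context complex_hilbert_space
begin

lemma op_exp_eigenvector:
  assumes "clin A" "blinfun_apply A v = scaleC \<kappa> v"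
  shows "op_exp (op_scale scaleC t A) v = scaleC (exp (t * \<kappa>)) v"
proof -
  have pow: "op_power A n v = scaleC (\<kappa> ^ n) v" for n
    by (induction n) (simp_all add: assms clinD mult_ac)
  have "(\<lambda>n. scaleC ((t * \<kappa>) ^ n /\<^sub>R fact n) v) sums scaleC (exp (t * \<kappa>)) v"
    by (intro bounded_linear.sums[OF bounded_bilinear.bounded_linear_left[OF bounded_bilinear_scaleC]]
        exp_converges)
  moreover have "scaleC ((t * \<kappa>) ^ n /\<^sub>R fact n) v = (1 / fact n) *\<^sub>R op_power (op_scale scaleC t A) n v" for n
    by (simp add: op_power_op_scale[OF assms(1)] op_scale_apply pow power_mult_distrib divide_inverse
        bounded_bilinear.scaleR_left[OF bounded_bilinear_scaleC])
  ultimately show ?thesis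
    using op_exp_apply_sums[of "op_scale scaleC t A" v] sums_unique2 by simp
qed

text \<open>The phase c is shared by all factors but may vary with v. The set is therefore closed
  under complex scalars, though in general not under sums, and is used through its span.\<close>

definition extremal_vectors :: "('v \<Rightarrow>\<^sub>L 'v) list \<Rightarrow> 'v set"
  where "extremal_vectors As =
    {v. \<exists>c. cmod c = 1 \<and> (\<forall>A\<in>set As. blinfun_apply A v = scaleC (c * complex_of_real (norm A)) v)}"

lemma scaleC_extremal_vectors:
  assumes "\<And>A. A \<in> set As \<Longrightarrow> clin A" "v \<in> extremal_vectors As"
  shows "scaleC d v \<in> extremal_vectors As"
  using assms unfolding extremal_vectors_def by (auto simp: clinD mult_ac)

lemma extremal_projection:
  assumes "\<forall>A\<in>set As. clin A"
  shows "\<exists>Q. clin Q \<and> (\<forall>A\<in>set As. \<forall>x. blinfun_apply Q (blinfun_apply A x) = A (Q x)) \<and>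
    (\<forall>v\<in>extremal_vectors As. Q v = v) \<and>
    (\<forall>S T x. (\<forall>v\<in>extremal_vectors As. blinfun_apply S v = blinfun_apply T v) \<longrightarrow>
       (S (Q x) :: 'v) = T (Q x))"
proof -
  have clin: "\<And>A. A \<in> set As \<Longrightarrow> clin A" using assms by blast
  \<comment> \<open>Multiplication by i joins the family so that the projection, constructed over
    the reals, becomes complex linear.\<close>
  define \<T> where "\<T> = insert (op_scale scaleC \<i> id_blinfun) (set As)"
  have inv: "blinfun_apply T v \<in> extremal_vectors As" if "T \<in> \<T>" "v \<in> extremal_vectors As" for T v
  proof -
    from that(2) obtain c where "\<forall>A\<in>set As. blinfun_apply A v = scaleC (c * complex_of_real (norm A)) v"
      unfolding extremal_vectors_def by blast
    then have "\<exists>d. blinfun_apply T v = scaleC d v"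
      using that(1) by (auto simp: \<T>_def op_scale_apply)
    then show ?thesis using scaleC_extremal_vectors[OF clin that(2)] by auto
  qed
  have orth: "T x \<bullet> v = 0"
    if T: "T \<in> \<T>" and v: "v \<in> extremal_vectors As" and x: "\<And>w. w \<in> extremal_vectors As \<Longrightarrow> x \<bullet> w = 0" for T v x
  proof (cases "T \<in> set As \<and> T \<noteq> 0")
    case True
    from v obtain c where c: "cmod c = 1" "\<forall>A\<in>set As. blinfun_apply A v = scaleC (c * complex_of_real (norm A)) v"
      unfolding extremal_vectors_def by blast
    have c0: "c \<noteq> 0" using c(1) by auto
    \<comment> \<open>u is the multiple of v that T maps to v. T attains its norm at u, so T x
      \<bullet> v reduces to x \<bullet> u.\<close>
    define u where "u = scaleC (1 / (c * complex_of_real (norm T))) v"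
    have u: "u \<in> extremal_vectors As" unfolding u_def by (rule scaleC_extremal_vectors[OF clin v])
    have Tu: "T u = v"
      using True c0 c(2) clin[of T] by (simp add: u_def clinD)
    have "norm (T u) = norm T * norm u"
      using True c(1) by (simp only: Tu) (simp add: u_def norm_scaleC norm_divide norm_mult)
    then have "T x \<bullet> T u = (norm T)\<^sup>2 * (x \<bullet> u)" by (rule norm_attained_inner)
    then show ?thesis by (simp add: Tu x[OF u])
  next
    case False
    then consider "T = 0" | "T = op_scale scaleC \<i> id_blinfun" using T by (auto simp: \<T>_def)
    then show ?thesis
    proof cases
      case 2
      have "scaleC \<i> x \<bullet> v = - Re (cinner x (scaleC \<i> v))"
        by (simp add: cinner_scaleC_left cinner_scaleC_right flip: Re_cinner)
      also have "\<dots> = 0" using x[OF scaleC_extremal_vectors[OF clin v]] by (simp add: Re_cinner)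
      finally show ?thesis using 2 by (simp add: op_scale_apply)
    qed simp
  qed
  show ?thesis
  proof (rule invariant_projection[of \<T> "extremal_vectors As"])
    fix Q :: "'v \<Rightarrow>\<^sub>L 'v"
    assume Q: "\<And>T x. T \<in> \<T> \<Longrightarrow> Q (T x) = T (Q x)" "\<And>v. v \<in> extremal_vectors As \<Longrightarrow> Q v = v"
      "\<And>(S :: 'v \<Rightarrow>\<^sub>L 'v) (T :: 'v \<Rightarrow>\<^sub>L 'v) x. (\<And>v. v \<in> extremal_vectors As \<Longrightarrow> S v = T v) \<Longrightarrow> S (Q x) = T (Q x)"
    have "Q (scaleC \<i> x) = scaleC \<i> (Q x)" for x
      using Q(1)[of "op_scale scaleC \<i> id_blinfun" x] by (simp add: \<T>_def op_scale_apply)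
    then have "clin Q"
      unfolding clin_def by (metis scaleC_eq blinfun.add_right blinfun.scaleR_right)
    moreover have "Q (A x) = A (Q x)" if "A \<in> set As" for A x
      using Q(1) that by (simp add: \<T>_def)
    ultimately show ?thesis using Q(2,3) by blast
  qed (use inv orth in blast)+
qed

end

section \<open>Analytic continuation of the logarithm of the product\<close>

text \<open>Two spaces are allowed because C will be either the projection onto the extremal part or
  the embedding of a real space into its complexification.\<close>

lemma op_exp_intertwine:
  fixes C :: "'a::euclidean_space \<Rightarrow>\<^sub>L 'b::euclidean_space"
  assumes "\<And>x. C (blinfun_apply T x) = blinfun_apply T' (C x)"
  shows "C (op_exp T x) = op_exp T' (C x)"
proof -
  have pow: "C (op_power T n x) = op_power T' n (C x)" for n x
    by (induction n) (simp_all add: assms)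
  have "(\<lambda>n. C ((1 / fact n) *\<^sub>R op_power T n x)) sums C (op_exp T x)"
    by (intro bounded_linear.sums[OF blinfun.bounded_linear_right] op_exp_apply_sums)
  then show ?thesis
    using op_exp_apply_sums[of T' "C x"] sums_unique2 by (simp add: pow blinfun.scaleR_right)
qed

lemma op_prod_intertwine:
  fixes C :: "'a::real_normed_vector \<Rightarrow>\<^sub>L 'b::real_normed_vector"
  assumes "\<And>A x. A \<in> set As \<Longrightarrow> C (blinfun_apply (f A) x) = blinfun_apply (g A) (C x)"
  shows "C (op_prod (map f As) x) = op_prod (map g As) (C x)"
  using assms by (induction As) (simp_all add: op_prod_def)

lemma vangle_opposite: "x \<noteq> 0 \<Longrightarrow> c < 0 \<Longrightarrow> vangle x (c *\<^sub>R x) = pi"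
  by (subst vangle_eq_iff) (simp_all add: dot_square_norm power2_eq_square)

context complex_hilbert_space
begin

definition bch_prod :: "('v \<Rightarrow>\<^sub>L 'v) list \<Rightarrow> complex \<Rightarrow> 'v \<Rightarrow>\<^sub>L 'v"
  where "bch_prod As t = op_prod (map (\<lambda>A. op_exp (op_scale scaleC t A)) As)"

lemma clin_bch_prod: "(\<And>A. A \<in> set As \<Longrightarrow> clin A) \<Longrightarrow> clin (bch_prod As t)"
  unfolding bch_prod_def by (intro clin_op_prod) (auto intro!: clin_op_exp clin_closure)

lemma op_scale_0 [simp]: "op_scale scaleC 0 A = 0"
  by (intro blinfun_eqI) (simp add: op_scale_apply)

lemma bch_prod_0 [simp]: "bch_prod As 0 = id_blinfun"
  unfolding bch_prod_def by (induction As) (auto intro!: blinfun_eqI)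

lemma bch_prod_commute:
  assumes "clin Q" "\<And>A x. A \<in> set As \<Longrightarrow> blinfun_apply Q (blinfun_apply A x) = A (Q x)"
  shows "Q (bch_prod As t x) = bch_prod As t (Q x)"
  unfolding bch_prod_def
  by (intro op_prod_intertwine op_exp_intertwine) (simp add: op_scale_apply assms clinD)

text \<open>The quarter turn \<open>x \<mapsto> e\<close> shared by the factors has the extremal eigenvectors \<open>x \<plusminus> \<i> e\<close>.\<close>

lemma bch_prod_negative_eigenvector:
  assumes clin: "\<And>A. A \<in> set As \<Longrightarrow> clin A" and sum: "(\<Sum>A\<leftarrow>As. norm A) = pi"
    and Q: "clin Q" "\<And>A x. A \<in> set As \<Longrightarrow> blinfun_apply Q (blinfun_apply A x) = A (Q x)"
      "\<And>v. v \<in> extremal_vectors As \<Longrightarrow> Q v = v"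
    and t: "cmod t \<le> 1" and x: "bch_prod As t x = c *\<^sub>R x" "c \<le> 0" "Q x = 0"
  shows "x = 0"
proof (rule ccontr)
  assume "x \<noteq> 0"
  define Bs where "Bs = map (op_scale scaleC t) As"
  have F: "bch_prod As t = op_prod (map op_exp Bs)" by (simp add: bch_prod_def Bs_def o_def)
  have S: "(\<Sum>B\<leftarrow>Bs. norm B) = cmod t * pi"
    by (simp add: Bs_def o_def norm_op_scale sum_list_const_mult sum)
  have "bch_prod As t x \<noteq> 0" unfolding F using \<open>x \<noteq> 0\<close> by (rule op_prod_exp_nonzero)
  with x have "c < 0" by (cases "c = 0") auto
  then have pi: "vangle x (op_prod (map op_exp Bs) x) = pi"
    using vangle_opposite[OF \<open>x \<noteq> 0\<close>] x(1) by (simp add: F)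
  \<comment> \<open>A total turn of |t| pi must cover the angle pi, so |t| = 1 and the equality case
    applies.\<close>
  have "pi \<le> cmod t * pi" using vangle_op_prod_exp_le[OF \<open>x \<noteq> 0\<close>, of Bs] by (simp add: pi S)
  then have t1: "cmod t = 1" using t by simp
  then obtain e where e: "\<And>B. B \<in> set Bs \<Longrightarrow> blinfun_apply B x = norm B *\<^sub>R e \<and> blinfun_apply B e = - norm B *\<^sub>R x"
    using op_prod_exp_max_angle[OF \<open>x \<noteq> 0\<close>, of Bs] pi S by auto
  have t0: "t \<noteq> 0" using t1 by auto
  have A: "scaleC t (blinfun_apply A x) = norm A *\<^sub>R e" "scaleC t (blinfun_apply A e) = - norm A *\<^sub>R x"
    if "A \<in> set As" for A
    using e[of "op_scale scaleC t A"] that t1 by (simp_all add: Bs_def op_scale_apply norm_op_scale)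
  \<comment> \<open>Since d * d = -1, t A (x + d e) = |A| (e - d x) = - d |A| (x + d e), so the
    common phase is - d / t.\<close>
  have ext: "x + scaleC d e \<in> extremal_vectors As" if "d = \<i> \<or> d = - \<i>" for d
    unfolding extremal_vectors_def
  proof (intro CollectI exI[of _ "- d / t"] conjI ballI)
    show "cmod (- d / t) = 1" using that t1 by (auto simp: norm_divide)
    fix A assume A': "A \<in> set As"
    have dd: "d * (d * z) = - z" for z using that by auto
    have "scaleC t (A (x + scaleC d e)) = scaleC t (A x) + scaleC d (scaleC t (A e))"
      using clin[OF A'] by (simp add: blinfun.add_right clinD scale_right_distrib mult.commute)
    also have "\<dots> = norm A *\<^sub>R e - scaleC d (norm A *\<^sub>R x)"
      unfolding A[OF A'] by simp
    also have "\<dots> = scaleC (- d * complex_of_real (norm A)) (x + scaleC d e)"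
      using dd[of "complex_of_real (norm A)"]
      by (simp add: scale_right_distrib scaleC_of_real[symmetric] mult.commute mult.left_commute flip: scale_minus_left)
    finally have "scaleC (1 / t) (scaleC t (A (x + scaleC d e))) = scaleC (1 / t) (scaleC (- d * complex_of_real (norm A)) (x + scaleC d e))"
      by simp
    then show "A (x + scaleC d e) = scaleC (- d / t * complex_of_real (norm A)) (x + scaleC d e)"
      using t0 by simp
  qed
  have "\<exists>A\<in>set As. norm A \<noteq> 0"
  proof (rule ccontr)
    assume "\<not> ?thesis"
    then have "map norm As = map (\<lambda>_. 0) As" by simp
    then have "(\<Sum>A\<leftarrow>As. norm A) = 0" by (simp only: sum_list_0)
    with sum show False by simp
  qed
  \<comment> \<open>A nonzero factor transfers Q x = 0 to Q e = 0. Then Q annihilates and also fixes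
    both x + i e and x - i e, so both vanish and with them x.\<close>
  then obtain A0 where A0: "A0 \<in> set As" "norm A0 \<noteq> 0" by blast
  have "norm A0 *\<^sub>R Q e = Q (scaleC t (A0 x))" using A(1)[OF A0(1)] by (simp add: blinfun.scaleR_right)
  also have "\<dots> = 0" using Q(1) Q(2)[OF A0(1), of x] x(3) by (simp add: clinD)
  finally have "Q e = 0" using A0(2) by simp
  then have "x + scaleC d e = 0" if "d = \<i> \<or> d = - \<i>" for d
    using Q(3)[OF ext[OF that]] x(3) Q(1) by (simp add: blinfun.add_right clinD)
  from this[of \<i>] this[of "- \<i>"] have "2 *\<^sub>R x = 0" by (simp add: scaleR_2 eq_neg_iff_add_eq_0)
  then show False using \<open>x \<noteq> 0\<close> by simp
qed

text \<open>The exponent of the product and the eigenvalue of t times the sum of the operators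
  agree: this is the linearity of the logarithm on extremal vectors.\<close>

lemma bch_prod_extremal_vector:
  assumes "\<And>A. A \<in> set As \<Longrightarrow> clin A"
    and "\<And>A. A \<in> set As \<Longrightarrow> blinfun_apply A v = scaleC (c * complex_of_real (norm A)) v"
  shows "bch_prod As t v = scaleC (exp (t * (c * complex_of_real (\<Sum>A\<leftarrow>As. norm A)))) v
    \<and> sum_list As v = scaleC (c * complex_of_real (\<Sum>A\<leftarrow>As. norm A)) v"
  using assms
proof (induction As)
  case (Cons A As)
  have "op_exp (op_scale scaleC t A) v = scaleC (exp (t * (c * complex_of_real (norm A)))) v"
    using Cons.prems by (intro op_exp_eigenvector) auto
  moreover have "clin (op_exp (op_scale scaleC t A))"
    using Cons.prems by (intro clin_op_exp clin_closure) auto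
  ultimately show ?case
    using Cons by (simp add: bch_prod_def clinD blinfun.add_left scale_left_distrib distrib_left exp_add mult_ac)
qed (simp add: bch_prod_def)

lemma op_log_eigenvector:
  assumes near: "norm (A - id_blinfun) \<le> 1 / 2" and "clin A" and v: "blinfun_apply A v = scaleC \<zeta> v"
  shows "op_log A v = scaleC (Ln \<zeta>) v"
proof (cases "v = 0")
  case False
  have adm: "log_admissible A" using near by (intro log_admissible_near_id) simp
  have "cmod (\<zeta> - 1) * norm v = norm ((A - id_blinfun) v)"
    by (simp add: blinfun.diff_left v norm_scaleC[symmetric] scale_left_diff_distrib)
  also have "\<dots> \<le> 1 / 2 * norm v"
    using norm_blinfun[of "A - id_blinfun" v] mult_right_mono[OF near norm_ge_zero] by (rule order_trans)
  finally have \<zeta>: "cmod (\<zeta> - 1) < 1" using False by simp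
  define q where "q l = complex_of_real l + (1 - complex_of_real l) * \<zeta>" for l
  have seg: "op_segment l A (scaleC k v) = scaleC (k * q l) v" for k l
    by (simp add: op_segment_apply clinD[OF \<open>clin A\<close>] v q_def scale_left_distrib distrib_left mult_ac flip: scaleC_of_real)
  have int: "(A - id_blinfun) (op_inverse (op_segment l A) v) = scaleC ((\<zeta> - 1) / q l) v" if "l \<in> {0..1}" for l
  proof -
    have inj: "op_injective (op_segment l A)" using adm that by (auto intro: log_admissibleD)
    have "q l \<noteq> 0"
      using inj seg[of l 1] False by (auto simp: op_injective_def)
    then have "op_segment l A (scaleC (1 / q l) v) = v" by (simp add: seg)
    then have "op_inverse (op_segment l A) v = scaleC (1 / q l) v"
      using op_inverse_apply(2)[OF inj] by metis
    then show ?thesis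
      by (simp add: blinfun.diff_left clinD[OF \<open>clin A\<close>] v flip: scale_left_diff_distrib)
        (simp add: diff_divide_distrib)
  qed
  have "((\<lambda>l. scaleC ((\<zeta> - 1) / q l) v) has_integral scaleC (Ln \<zeta>) v) {0..1}"
    using has_integral_linear[OF Ln_segment_integral[OF \<zeta>]
      bounded_bilinear.bounded_linear_left[OF bounded_bilinear_scaleC, of v]]
    by (simp add: o_def q_def)
  then have "((\<lambda>l. (A - id_blinfun) (op_inverse (op_segment l A) v)) has_integral scaleC (Ln \<zeta>) v) {0..1}"
    by (rule has_integral_eq[rotated]) (simp add: int)
  then show ?thesis using op_log_apply[OF adm] by (simp add: integral_unique)
qed simp

lemma op_holomorphic_on_bch_prod:
  "(\<And>A. A \<in> set As \<Longrightarrow> clin A) \<Longrightarrow> op_holomorphic_on (bch_prod As) (ball 0 R)"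
  unfolding bch_prod_def[abs_def] by (rule op_holomorphic_on_op_prod)

lemma bch_prod_near_id:
  assumes "\<And>A. A \<in> set As \<Longrightarrow> clin A"
  shows "\<forall>\<^sub>F t in nhds 0. norm (bch_prod As t - id_blinfun) \<le> 1 / 2"
proof -
  have "continuous_on (ball 0 1) (bch_prod As)"
    by (intro op_holomorphic_on_continuous op_holomorphic_on_bch_prod assms)
  then have "isCont (bch_prod As) 0" by (simp add: continuous_on_eq_continuous_at)
  then have "(bch_prod As \<longlongrightarrow> bch_prod As 0) (nhds 0)"
    by (simp only: isCont_def tendsto_at_iff_tendsto_nhds)
  then have "\<forall>\<^sub>F t in nhds 0. dist (bch_prod As t) (bch_prod As 0) < 1 / 2" by (rule tendstoD) simp
  then show ?thesis by eventually_elim (simp add: dist_norm)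
qed

text \<open>K is the analytic continuation of the logarithm. Its two summands treat the complement
  of the extremal part and the extremal part itself.\<close>

lemma bch_continuation:
  assumes clin: "\<And>A. A \<in> set As \<Longrightarrow> clin A" and sum: "(\<Sum>A\<leftarrow>As. norm A) = pi"
  obtains K r where "1 < r" "op_holomorphic_on K (ball 0 r)" "\<And>t. t \<in> ball 0 r \<Longrightarrow> clin (K t)" "K 0 = 0"
    "\<forall>\<^sub>F t in nhds 0. K t = op_log (bch_prod As t)"
proof -
  have "\<forall>A\<in>set As. clin A" using clin by blast
  then obtain Q where Q': "clin Q" "\<forall>A\<in>set As. \<forall>x. blinfun_apply Q (blinfun_apply A x) = A (Q x)"
    "\<forall>v\<in>extremal_vectors As. Q v = v"
    "\<forall>S T x. (\<forall>v\<in>extremal_vectors As. blinfun_apply S v = blinfun_apply T v) \<longrightarrow>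
       (S (Q x) :: 'v) = T (Q x)"
    by - (drule extremal_projection, elim exE conjE, rule that, assumption+)
  have Q: "clin Q" "\<And>A x. A \<in> set As \<Longrightarrow> blinfun_apply Q (blinfun_apply A x) = A (Q x)"
    "\<And>v. v \<in> extremal_vectors As \<Longrightarrow> Q v = v"
    and Q_ext: "\<And>S T x. (\<And>v. v \<in> extremal_vectors As \<Longrightarrow> blinfun_apply S v = blinfun_apply T v) \<Longrightarrow>
       (S (Q x) :: 'v) = T (Q x)"
    using Q' by simp_all
  define F where "F = bch_prod As"
  \<comment> \<open>H equals F on the kernel of Q and the identity on its range, where log H is 0
    and where K contributes its linear term instead.\<close>
  define H where "H t = (F t o\<^sub>L (id_blinfun - Q)) + Q" for t
  define K where "K t = op_log (H t) + op_scale scaleC t (sum_list As o\<^sub>L Q)" for t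
  have QQ: "blinfun_apply Q (Q x) = Q x" for x using Q_ext[of Q id_blinfun x] Q(3) by simp
  have QF: "Q (F t x) = F t (Q x)" for t x
    unfolding F_def by (rule bch_prod_commute[OF Q(1,2)])
  have clinF: "clin (F t)" for t unfolding F_def by (rule clin_bch_prod[OF clin])
  have clinH: "clin (H t)" for t unfolding H_def by (intro clin_closure clinF Q(1))
  have H_apply: "H t x = F t (x - Q x) + Q x" for t x by (simp add: H_def blinfun.bilinear_simps)
  have QH: "blinfun_apply Q (H t x) = Q x" for t x by (simp add: H_apply blinfun.bilinear_simps QQ QF)
  have holoF: "op_holomorphic_on F (ball 0 R)" for R
    unfolding F_def by (rule op_holomorphic_on_bch_prod[OF clin])
  have holoH: "op_holomorphic_on H (ball 0 R)" for R
    using holoF[of R] unfolding op_holomorphic_on_def H_apply cinner_add_right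
    by (intro allI holomorphic_intros) auto
  have adm: "log_admissible (H t)" if t: "cmod t \<le> 1" for t
    unfolding log_admissible_def op_injective_def
  proof (intro ballI allI impI)
    fix l :: real and x
    assume l: "l \<in> {0..1}" and x: "op_segment l (H t) x = 0"
    \<comment> \<open>Q applied to the segment gives Q x itself, so kernel vectors lie in the kernel
      of Q, where H is F and negative eigenvalues have been excluded.\<close>
    have "Q (op_segment l (H t) x) = l *\<^sub>R Q x + (1 - l) *\<^sub>R Q x"
      by (simp add: op_segment_apply blinfun.bilinear_simps QH)
    then have Qx: "Q x = 0" using x by (simp add: algebra_simps)
    have Fx: "l *\<^sub>R x + (1 - l) *\<^sub>R F t x = 0" using x by (simp add: op_segment_apply H_apply Qx)
    show "x = 0"
    proof (cases "l = 1")
      case False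
      have "(1 - l) *\<^sub>R F t x = (1 - l) *\<^sub>R (- l / (1 - l)) *\<^sub>R x"
        using Fx False by (simp add: add_eq_0_iff2)
      then have "F t x = (- l / (1 - l)) *\<^sub>R x"
        using False by (metis right_minus_eq scaleR_cancel_left)
      moreover have "- l / (1 - l) \<le> 0" using l by (simp add: divide_nonneg_nonneg)
      ultimately show ?thesis
        using bch_prod_negative_eigenvector[OF clin sum Q(1-3) t] Qx unfolding F_def by blast
    qed (use Fx in simp)
  qed
  have "continuous_on (cball 0 2) H"
    by (rule continuous_on_subset[OF op_holomorphic_on_continuous[OF holoH[of 3]]]) auto
  then obtain r where r: "1 < r" "\<And>t. cmod t < r \<Longrightarrow> log_admissible (H t)"
    using adm log_admissible_enlarge_disc by blast
  have K_eq: "K t = op_log (F t)" if t: "cmod t < 1" and near: "norm (F t - id_blinfun) \<le> 1 / 2" for t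
  proof (rule blinfun_eqI)
    fix x
    have admF: "log_admissible (F t)" using near by (intro log_admissible_near_id) simp
    have admH: "log_admissible (H t)" using r t by simp
    have "op_log (F t) v = op_scale scaleC t (sum_list As) v" if v: "v \<in> extremal_vectors As" for v
    proof -
      from v obtain c where c: "cmod c = 1" "\<forall>A\<in>set As. blinfun_apply A v = scaleC (c * complex_of_real (norm A)) v"
        unfolding extremal_vectors_def by blast
      \<comment> \<open>The bound |t| < 1 keeps t c pi in the strip where the principal logarithm
        inverts exp.\<close>
      have "\<bar>Im (t * (c * complex_of_real pi))\<bar> \<le> cmod (t * (c * complex_of_real pi))" by (rule abs_Im_le_cmod)
      also have "\<dots> < pi" using t by (simp add: norm_mult c(1))
      finally have "Ln (exp (t * (c * complex_of_real pi))) = t * (c * complex_of_real pi)"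
        by (intro Ln_exp) auto
      moreover have *: "F t v = scaleC (exp (t * (c * complex_of_real pi))) v"
        "sum_list As v = scaleC (c * complex_of_real pi) v"
        using bch_prod_extremal_vector[of As v c t, OF clin] c(2) by (simp_all add: F_def sum)
      ultimately show ?thesis
        using op_log_eigenvector[OF near clinF *(1)] by (simp add: *(2) op_scale_apply)
    qed
    then have 1: "op_log (F t) (Q x) = scaleC t (sum_list As (Q x))"
      using Q_ext[of "op_log (F t)" "op_scale scaleC t (sum_list As)" x] by (simp add: op_scale_apply)
    \<comment> \<open>The integrands of log H at x and log F at x - Q x agree: H - id annihilates
      the range of Q, and the resolvents are related by u - Q u.\<close>
    have "(H t - id_blinfun) (op_inverse (op_segment l (H t)) x) =
        (F t - id_blinfun) (op_inverse (op_segment l (F t)) (x - Q x))" if l: "l \<in> {0..1}" for l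
    proof -
      define u where "u = op_inverse (op_segment l (H t)) x"
      have "op_segment l (H t) u = x"
        unfolding u_def using admH l by (intro op_inverse_apply log_admissibleD) auto
      then have xu: "x = l *\<^sub>R u + (1 - l) *\<^sub>R (F t (u - Q u) + Q u)" by (simp add: op_segment_apply H_apply)
      have "Q x = Q u" by (subst xu) (simp add: blinfun.bilinear_simps QQ QF algebra_simps)
      then have "op_segment l (F t) (u - Q u) = x - Q x"
        by (subst xu) (simp add: op_segment_apply algebra_simps)
      then have "op_inverse (op_segment l (F t)) (x - Q x) = u - Q u"
        using op_inverse_apply(2)[OF log_admissibleD[OF admF], of l "u - Q u"] l by simp
      then show ?thesis
        by (simp add: u_def[symmetric] blinfun.diff_left H_apply)
    qed
    then have "op_log (H t) x = op_log (F t) (x - Q x)"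
      unfolding op_log_apply[OF admH] op_log_apply[OF admF] by (rule integral_cong)
    with 1 show "K t x = op_log (F t) x"
      by (simp add: K_def blinfun.bilinear_simps op_scale_apply)
  qed
  have "\<forall>\<^sub>F t in nhds 0. norm (F t - id_blinfun) \<le> 1 / 2"
    unfolding F_def by (rule bch_prod_near_id[OF clin])
  moreover have "\<forall>\<^sub>F t in nhds 0. cmod t < 1"
    using eventually_nhds_ball[of 1 "0::complex"] by simp
  ultimately have ev: "\<forall>\<^sub>F t in nhds 0. K t = op_log (F t)"
    by eventually_elim (auto intro!: K_eq)
  show thesis
  proof
    show "op_holomorphic_on K (ball 0 r)"
      unfolding op_holomorphic_on_def
    proof (intro allI)
      fix e x
      have "op_holomorphic_on (\<lambda>t. op_log (H t)) (ball 0 r)"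
        by (intro op_holomorphic_on_op_log holoH clinH r(2)) auto
      then have "(\<lambda>t. cinner e (op_log (H t) x) + t * cinner e (sum_list As (Q x))) holomorphic_on ball 0 r"
        by (intro holomorphic_intros op_holomorphic_onD)
      then show "(\<lambda>t. cinner e (K t x)) holomorphic_on ball 0 r"
        by (simp add: K_def blinfun.bilinear_simps cinner_simps op_scale_apply)
    qed
    show "clin (K t)" if "t \<in> ball 0 r" for t
    proof -
      have "clin (sum_list As)" using clin by (induction As) (auto simp: clin_def blinfun.bilinear_simps scale_right_distrib)
      then show ?thesis
        unfolding K_def using that by (intro clin_closure clin_op_log clinH r(2) Q(1)) simp
    qed
    show "K 0 = 0" using K_eq[of 0] by (simp add: F_def)
  qed (use r(1) ev in \<open>simp_all add: F_def\<close>)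
qed

end

section \<open>Power series\<close>

text \<open>Zeros of a nonzero power series are isolated. The field stays general to serve real and
  complex t alike.\<close>

lemma powser_eq_0_imp_coeff_eq_0:
  fixes d :: "nat \<Rightarrow> 'k::{real_normed_field,banach}"
  assumes "\<forall>\<^sub>F t in nhds 0. (\<lambda>n. d n * t ^ Suc n) sums 0"
  shows "d n = 0"
proof (rule ccontr)
  assume "d n \<noteq> 0"
  obtain r where r: "r > 0" "\<And>t. norm t < r \<Longrightarrow> (\<lambda>n. d n * t ^ Suc n) sums 0"
    using assms by (auto simp: eventually_nhds_metric)
  define a where "a n = (case n of 0 \<Rightarrow> 0 | Suc m \<Rightarrow> d m)" for n
  have a: "(\<lambda>n. a n * (t - 0) ^ n) sums 0" if "norm (t - 0) < r" for t
    using r(2)[of t] that sums_Suc_iff[of "\<lambda>n. a n * t ^ n" 0] by (simp add: a_def)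
  show False
  proof (rule powser_0_nonzero[OF r(1) a refl, where m = "Suc n"])
    show "a (Suc n) \<noteq> 0" using \<open>d n \<noteq> 0\<close> by (simp add: a_def)
    fix s :: real assume s: "0 < s" "\<And>z :: 'k. z \<in> cball 0 s - {0} \<Longrightarrow> (0 :: 'k) \<noteq> 0"
    have "(of_real s :: 'k) \<in> cball 0 s - {0}" using s(1) by simp
    from s(2)[OF this] show False by simp
  qed simp_all
qed

text \<open>A separating family of scalar functionals \<phi> reduces operator series to scalar ones;
  it is the inner product in the real case and the Hermitian form in the complex case.\<close>

lemma op_series_unique:
  fixes smul :: "'k::{real_normed_field,banach} \<Rightarrow> 'v::real_normed_vector \<Rightarrow> 'v" and \<phi> :: "'e \<Rightarrow> 'v \<Rightarrow> 'k"
  assumes app: "\<And>c A x. blinfun_apply (op_scale smul c A) x = smul c (A x)"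
    and lin: "\<And>e. bounded_linear (\<phi> e)" and \<phi>: "\<And>e c x. \<phi> e (smul c x) = c * \<phi> e x"
    and sep: "\<And>x. (\<And>e. \<phi> e x = 0) \<Longrightarrow> x = 0"
    and \<mu>: "\<forall>\<^sub>F t in nhds 0. (\<lambda>n. op_scale smul (t ^ Suc n) (\<mu> (Suc n))) sums L t"
    and \<nu>: "\<forall>\<^sub>F t in nhds 0. (\<lambda>n. op_scale smul (t ^ Suc n) (\<nu> (Suc n))) sums L t"
    and 0: "\<mu> 0 = \<nu> 0"
  shows "\<mu> = \<nu>"
proof
  fix n
  show "\<mu> n = \<nu> n"
  proof (cases n)
    case (Suc m)
    have "\<phi> e (\<mu> (Suc m) x) - \<phi> e (\<nu> (Suc m) x) = 0" for e x
    proof (rule powser_eq_0_imp_coeff_eq_0[of "\<lambda>m. \<phi> e (\<mu> (Suc m) x) - \<phi> e (\<nu> (Suc m) x)"])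
      have bl: "bounded_linear (\<lambda>T. \<phi> e (blinfun_apply T x))"
        by (intro bounded_linear_compose[OF lin] blinfun.bounded_linear_left)
      from \<mu> \<nu> show "\<forall>\<^sub>F t in nhds 0. (\<lambda>m. (\<phi> e (\<mu> (Suc m) x) - \<phi> e (\<nu> (Suc m) x)) * t ^ Suc m) sums 0"
      proof eventually_elim
        case (elim t)
        from sums_diff[OF bounded_linear.sums[OF bl elim(1)] bounded_linear.sums[OF bl elim(2)]]
        show ?case by (simp add: app \<phi> algebra_simps)
      qed
    qed
    then have "\<phi> e (\<mu> (Suc m) x - \<nu> (Suc m) x) = 0" for e x
      using linear_diff[OF bounded_linear.linear[OF lin]] by simp
    then have "\<mu> (Suc m) x - \<nu> (Suc m) x = 0" for x by (rule sep)
    then show ?thesis by (simp add: Suc blinfun_eqI)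
  qed (simp add: 0)
qed

lemma op_conv_radius_gt_1:
  fixes \<mu> :: "nat \<Rightarrow> 'v::real_normed_vector"
  assumes "1 < \<rho>" "\<And>n. norm (\<mu> n) \<le> M / \<rho> ^ n"
  shows "op_conv_radius \<mu> > 1"
proof -
  \<comment> \<open>Raising M to at least 1 makes it positive, so its n-th roots tend to 1.\<close>
  define M' where "M' = max M 1"
  have "root n (norm (\<mu> n)) \<le> root n M' / \<rho>" if "n > 0" for n
  proof -
    have "norm (\<mu> n) \<le> M' / \<rho> ^ n"
      using assms(1) by (intro order_trans[OF assms(2) divide_right_mono]) (auto simp: M'_def)
    then have "root n (norm (\<mu> n)) \<le> root n (M' / \<rho> ^ n)" using that by simp
    also have "\<dots> = root n M' / \<rho>" using that assms(1) by (simp add: real_root_divide real_root_power_cancel)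
    finally show ?thesis .
  qed
  then have "\<forall>\<^sub>F n in sequentially. ereal (root n (norm (\<mu> n))) \<le> ereal (root n M' / \<rho>)"
    by (auto intro: eventually_sequentiallyI[of 1])
  then have "limsup (\<lambda>n. ereal (root n (norm (\<mu> n)))) \<le> limsup (\<lambda>n. ereal (root n M' / \<rho>))"
    by (rule Limsup_mono)
  also have "(\<lambda>n. root n M' / \<rho>) \<longlonglongrightarrow> 1 / \<rho>"
    using assms(1) by (intro tendsto_divide LIMSEQ_root_const tendsto_const) (auto simp: M'_def)
  then have "limsup (\<lambda>n. ereal (root n M' / \<rho>)) = ereal (1 / \<rho>)"
    by (intro lim_imp_Limsup) auto
  finally have le: "limsup (\<lambda>n. ereal (root n (norm (\<mu> n)))) \<le> ereal (1 / \<rho>)" .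
  have "0 \<le> limsup (\<lambda>n. ereal (root n (norm (\<mu> n))))"
    by (intro le_Limsup) (auto intro!: always_eventually simp: real_root_ge_zero)
  then have "inverse (ereal (1 / \<rho>)) \<le> op_conv_radius \<mu>"
    unfolding op_conv_radius_def using le by (rule ereal_inverse_antimono)
  moreover have "1 < inverse (ereal (1 / \<rho>))" using assms(1) by (simp add: one_ereal_def)
  ultimately show ?thesis by (rule less_le_trans[rotated])
qed

lemma geometric_bound_summable:
  fixes \<mu> :: "nat \<Rightarrow> 'v::banach"
  assumes "1 < \<rho>" "\<And>n. norm (\<mu> n) \<le> M / \<rho> ^ n"
  shows "summable (\<lambda>n. \<mu> (Suc n))"
proof -
  have "summable (\<lambda>n. M * (1 / \<rho>) ^ n)"
    using assms(1) by (intro summable_mult summable_geometric) simp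
  then have "summable \<mu>"
    by (rule summable_comparison_test[rotated]) (use assms in \<open>auto simp: power_divide\<close>)
  then show ?thesis by (simp add: summable_Suc_iff)
qed

context complex_hilbert_space
begin

text \<open>The factor 1/4 comes from expanding argument and value in the frame, each with a factor
  1/2.\<close>

definition matrix_unit :: "'v \<Rightarrow> 'v \<Rightarrow> 'v \<Rightarrow>\<^sub>L 'v"
  where "matrix_unit b b' = Blinfun (\<lambda>y. (1 / 4) *\<^sub>R scaleC (cinner b' y) b)"

lemma matrix_unit_apply: "matrix_unit b b' y = (1 / 4) *\<^sub>R scaleC (cinner b' y) b"
  unfolding matrix_unit_def
  by (subst bounded_linear_Blinfun_apply)
    (auto intro!: bounded_linear_scaleR_right[THEN bounded_linear_compose]
      bounded_linear_compose[OF bounded_bilinear.bounded_linear_left[OF bounded_bilinear_scaleC] bounded_linear_cinner])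

lemma clin_expansion:
  assumes "clin A"
  shows "A = (\<Sum>b\<in>Basis. \<Sum>b'\<in>Basis. op_scale scaleC (cinner b (A b')) (matrix_unit b b'))"
proof (rule blinfun_eqI)
  fix y
  have "A y = (1 / 2) *\<^sub>R (\<Sum>b\<in>Basis. scaleC ((\<Sum>b'\<in>Basis. cinner b (A b') * cinner b' y) / 2) b)"
    by (subst tight_frame[of "A y"]) (simp only: cinner_clin[OF assms, of _ y])
  also have "\<dots> = (\<Sum>b\<in>Basis. \<Sum>b'\<in>Basis. scaleC (cinner b (A b')) ((1 / 4) *\<^sub>R scaleC (cinner b' y) b))"
    by (simp add: scaleC_right_simps scaleR_sum_right sum_divide_distrib scale_sum_left scaleC_of_real[symmetric] mult_ac)
  finally show "A y = (\<Sum>b\<in>Basis. \<Sum>b'\<in>Basis. op_scale scaleC (cinner b (A b')) (matrix_unit b b')) y"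
    by (simp add: blinfun.sum_left op_scale_apply matrix_unit_apply)
qed

text \<open>The Taylor coefficients of the matrix coefficients are reassembled into operators by
  \<open>clin_expansion\<close>.\<close>

lemma op_holomorphic_power_series:
  assumes holo: "op_holomorphic_on K (ball 0 r)" and r: "1 < r"
    and clin: "\<And>t. t \<in> ball 0 r \<Longrightarrow> clin (K t)" and K0: "K 0 = 0"
  shows "\<exists>\<mu> M \<rho>. \<mu> 0 = 0 \<and> (\<forall>t\<in>ball 0 r. (\<lambda>n. op_scale scaleC (t ^ Suc n) (\<mu> (Suc n))) sums K t) \<and>
    1 < \<rho> \<and> (\<forall>n. norm (\<mu> n) \<le> M / \<rho> ^ n)"
proof -
  define c where "c n b b' = (deriv ^^ n) (\<lambda>t. cinner b (K t b')) 0 / fact n" for n b b'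
  define \<mu> where "\<mu> n = (\<Sum>b\<in>Basis. \<Sum>b'\<in>Basis. op_scale scaleC (c n b b') (matrix_unit b b'))" for n
  have \<mu>0: "\<mu> 0 = 0" by (simp add: \<mu>_def c_def K0 cinner_simps)
  have sums: "(\<lambda>n. op_scale scaleC (t ^ n) (\<mu> n)) sums K t" if t: "t \<in> ball 0 r" for t
  proof -
    have "(\<lambda>n. c n b b' * t ^ n) sums cinner b (K t b')" for b b'
      using holomorphic_power_series[OF op_holomorphic_onD[OF holo, of b b'] t] by (simp add: c_def)
    then have "(\<lambda>n. \<Sum>b\<in>Basis. \<Sum>b'\<in>Basis. op_scale scaleC (c n b b' * t ^ n) (matrix_unit b b')) sums
        (\<Sum>b\<in>Basis. \<Sum>b'\<in>Basis. op_scale scaleC (cinner b (K t b')) (matrix_unit b b'))"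
      by (intro sums_sum bounded_linear.sums[OF bounded_linear_op_scale_left])
    moreover have "(\<Sum>b\<in>Basis. \<Sum>b'\<in>Basis. op_scale scaleC (c n b b' * t ^ n) (matrix_unit b b'))
        = op_scale scaleC (t ^ n) (\<mu> n)" for n
      by (intro blinfun_eqI)
        (simp add: \<mu>_def op_scale_apply blinfun.sum_left scaleC_right_simps mult.commute)
    ultimately show ?thesis using clin_expansion[OF clin[OF t]] by simp
  qed
  have "(\<lambda>n. op_scale scaleC (t ^ Suc n) (\<mu> (Suc n))) sums K t" if "t \<in> ball 0 r" for t
    using sums[OF that] by (subst sums_Suc_iff) (simp add: \<mu>0 op_scale_def zero_blinfun_def[symmetric])
  moreover
  \<comment> \<open>The series converges at a point \<rho> strictly between 1 and r, so its terms
    there are bounded; this gives the geometric bound.\<close>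
  define \<rho> where "\<rho> = (1 + r) / 2"
  have \<rho>: "1 < \<rho>" "\<rho> < r" using r by (simp_all add: \<rho>_def)
  have "(\<lambda>n. op_scale scaleC (complex_of_real \<rho> ^ n) (\<mu> n)) \<longlonglongrightarrow> 0"
    using sums[of "complex_of_real \<rho>"] \<rho> by (intro summable_LIMSEQ_zero sums_summable) simp
  then have "Bseq (\<lambda>n. op_scale scaleC (complex_of_real \<rho> ^ n) (\<mu> n))"
    by (intro convergent_imp_Bseq convergentI)
  then obtain M where "\<And>n. norm (op_scale scaleC (complex_of_real \<rho> ^ n) (\<mu> n)) \<le> M"
    by (auto simp: Bseq_def)
  then have "norm (\<mu> n) \<le> M / \<rho> ^ n" for n
    using \<rho> by (simp add: norm_op_scale norm_power field_simps)
  ultimately show ?thesis using \<mu>0 \<rho>(1) by blast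
qed

lemma bch_series:
  assumes "\<forall>A\<in>set As. clin A" and sum: "(\<Sum>A\<leftarrow>As. norm A) = pi"
  shows "\<exists>\<mu> M \<rho>. \<mu> 0 = 0 \<and> 1 < \<rho> \<and> (\<forall>n. norm (\<mu> n) \<le> M / \<rho> ^ n) \<and>
    (\<forall>\<^sub>F t in nhds 0. (\<lambda>n. op_scale scaleC (t ^ Suc n) (\<mu> (Suc n))) sums op_log (bch_prod As t))"
proof -
  show ?thesis
  proof (rule bch_continuation[of As])
    fix K r
    assume K: "1 < r" "op_holomorphic_on K (ball 0 r)" "\<And>t. t \<in> ball 0 r \<Longrightarrow> clin (K t)" "K 0 = 0"
      "\<forall>\<^sub>F t in nhds 0. K t = op_log (bch_prod As t)"
    have "\<exists>\<mu> M \<rho>. \<mu> 0 = 0 \<and> (\<forall>t\<in>ball 0 r. (\<lambda>n. op_scale scaleC (t ^ Suc n) (\<mu> (Suc n))) sums K t) \<and>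
      1 < \<rho> \<and> (\<forall>n. norm (\<mu> n) \<le> M / \<rho> ^ n)"
      using K(2,1,3,4) by (rule op_holomorphic_power_series)
    then obtain \<mu> M \<rho> where \<mu>: "\<mu> 0 = 0"
      "\<forall>t\<in>ball 0 r. (\<lambda>n. op_scale scaleC (t ^ Suc n) (\<mu> (Suc n))) sums K t"
      "1 < \<rho>" "\<forall>n. norm (\<mu> n) \<le> M / \<rho> ^ n"
      by (elim exE conjE)
    have "\<forall>\<^sub>F t in nhds 0. t \<in> ball (0::complex) r" using K(1) by (intro eventually_nhds_ball) simp
    with K(5) have "\<forall>\<^sub>F t in nhds 0. (\<lambda>n. op_scale scaleC (t ^ Suc n) (\<mu> (Suc n))) sums op_log (bch_prod As t)"
    proof eventually_elim
      case (elim t)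
      then show ?case using bspec[OF \<mu>(2), of t] by simp
    qed
    then show ?thesis using \<mu>(1,3,4) by blast
  qed (use assms in auto)
qed

lemma bch_coeff_eqI:
  assumes "\<mu> 0 = 0"
    "\<forall>\<^sub>F t in nhds 0. (\<lambda>n. op_scale scaleC (t ^ Suc n) (\<mu> (Suc n))) sums op_log (bch_prod As t)"
  shows "bch_coeff scaleC As = \<mu>"
  unfolding bch_coeff_def
proof (rule the_equality)
  fix \<nu> assume \<nu>: "\<nu> 0 = 0 \<and> (\<forall>\<^sub>F t in nhds 0. (\<lambda>n. op_scale scaleC (t ^ Suc n) (\<nu> (Suc n))) sums
    op_log (op_prod (map (\<lambda>A. op_exp (op_scale scaleC t A)) As)))"
  have "x = 0" if "\<And>e. cinner e x = 0" for x
    using that[of x] by (simp add: cinner_self)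
  then show "\<nu> = \<mu>"
    using assms \<nu> unfolding bch_prod_def
    by (intro op_series_unique[where \<phi> = cinner and smul = scaleC])
      (auto simp: op_scale_apply bounded_linear_cinner cinner_simps)
qed (use assms in \<open>simp add: bch_prod_def\<close>)

end

section \<open>Complexification\<close>

lemma op_log_intertwine:
  fixes C :: "'a::euclidean_space \<Rightarrow>\<^sub>L 'b::euclidean_space"
  assumes "log_admissible S" "log_admissible T" "\<And>x. C (blinfun_apply S x) = blinfun_apply T (C x)"
  shows "C (op_log S x) = op_log T (C x)"
proof -
  have "bounded_linear (\<lambda>U :: 'a \<Rightarrow>\<^sub>L 'a. C (blinfun_apply U x))"
    by (intro bounded_linear_compose[OF blinfun.bounded_linear_right] blinfun.bounded_linear_left)
  from op_log_bounded_linear[OF assms(1) this]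
  have "C (op_log S x) = integral {0..1} (\<lambda>l. C ((S - id_blinfun) (op_inverse (op_segment l S) x)))"
    by simp
  also have "\<dots> = integral {0..1} (\<lambda>l. (T - id_blinfun) (op_inverse (op_segment l T) (C x)))"
  proof (rule integral_cong)
    fix l :: real assume l: "l \<in> {0..1}"
    define u where "u = op_inverse (op_segment l S) x"
    have "op_segment l S u = x"
      unfolding u_def using assms(1) l by (intro op_inverse_apply log_admissibleD) auto
    then have "op_segment l T (C u) = C x"
      by (auto simp: op_segment_apply blinfun.bilinear_simps assms(3))
    then have "op_inverse (op_segment l T) (C x) = C u"
      using op_inverse_apply(2)[OF log_admissibleD[OF assms(2)], of l "C u"] l by simp
    then show "C ((S - id_blinfun) (op_inverse (op_segment l S) x)) =
        (T - id_blinfun) (op_inverse (op_segment l T) (C x))"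
      by (simp add: blinfun.bilinear_simps assms(3) flip: u_def)
  qed
  finally show ?thesis by (simp add: op_log_apply[OF assms(2)])
qed

text \<open>The pair (x, y) stands for x + i y. The product norm is already the Hilbert norm of the
  complexification.\<close>

definition pair_scaleC :: "complex \<Rightarrow> 'a \<times> 'a \<Rightarrow> 'a::euclidean_space \<times> 'a"
  where "pair_scaleC c z = (Re c *\<^sub>R fst z - Im c *\<^sub>R snd z, Re c *\<^sub>R snd z + Im c *\<^sub>R fst z)"

definition pair_cinner :: "'a \<times> 'a \<Rightarrow> 'a::euclidean_space \<times> 'a \<Rightarrow> complex"
  where "pair_cinner z w = Complex (fst z \<bullet> fst w + snd z \<bullet> snd w) (fst z \<bullet> snd w - snd z \<bullet> fst w)"

interpretation complexification: complex_hilbert_space "pair_scaleC :: complex \<Rightarrow> 'a \<times> 'a \<Rightarrow> 'a::euclidean_space \<times> 'a" pair_cinner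
proof
  fix x y z :: "'a \<times> 'a" and a b c :: complex and r :: real
  show "pair_scaleC a (x + y) = pair_scaleC a x + pair_scaleC a y"
    "pair_scaleC (a + b) x = pair_scaleC a x + pair_scaleC b x"
    "pair_scaleC a (pair_scaleC b x) = pair_scaleC (a * b) x" "pair_scaleC 1 x = x"
    "pair_scaleC (complex_of_real r) x = r *\<^sub>R x"
    by (simp_all add: pair_scaleC_def prod_eq_iff algebra_simps)
  show "pair_cinner x (y + z) = pair_cinner x y + pair_cinner x z"
    "pair_cinner x (pair_scaleC c y) = c * pair_cinner x y"
    "pair_cinner y x = cnj (pair_cinner x y)"
    by (simp_all add: pair_cinner_def pair_scaleC_def complex_eq_iff inner_add_right inner_diff_right inner_commute algebra_simps)
  show "pair_cinner x x = complex_of_real ((norm x)\<^sup>2)"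
    by (simp add: pair_cinner_def complex_eq_iff norm_prod_def inner_commute dot_square_norm)
qed

definition complexify :: "('a::euclidean_space \<Rightarrow>\<^sub>L 'a) \<Rightarrow> (('a \<times> 'a) \<Rightarrow>\<^sub>L ('a \<times> 'a))"
  where "complexify A = Blinfun (\<lambda>z. (blinfun_apply A (fst z), blinfun_apply A (snd z)))"

lemma complexify_apply: "blinfun_apply (complexify A) z = (blinfun_apply A (fst z), blinfun_apply A (snd z))"
  unfolding complexify_def
  by (subst bounded_linear_Blinfun_apply)
    (auto intro!: bounded_linear_Pair bounded_linear_compose[OF blinfun.bounded_linear_right]
      bounded_linear_fst bounded_linear_snd)

text \<open>Equality of norms carries the hypothesis that the norms add up to pi over to the
  complexified operators.\<close>

lemma norm_complexify: "norm (complexify A) = norm A"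
proof (rule antisym)
  show "norm (complexify A) \<le> norm A"
  proof (rule norm_blinfun_bound)
    fix z :: "'a \<times> 'a"
    have "(norm (A (fst z)))\<^sup>2 + (norm (A (snd z)))\<^sup>2 \<le> (norm A * norm (fst z))\<^sup>2 + (norm A * norm (snd z))\<^sup>2"
      by (intro add_mono power_mono norm_blinfun) simp_all
    also have "\<dots> = (norm A)\<^sup>2 * ((norm (fst z))\<^sup>2 + (norm (snd z))\<^sup>2)"
      by (simp add: power_mult_distrib distrib_left)
    finally have "sqrt ((norm (A (fst z)))\<^sup>2 + (norm (A (snd z)))\<^sup>2) \<le> sqrt ((norm A)\<^sup>2 * ((norm (fst z))\<^sup>2 + (norm (snd z))\<^sup>2))"
      by simp
    then show "norm (complexify A z) \<le> norm A * norm z"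
      by (simp add: complexify_apply norm_prod_def real_sqrt_mult)
  qed simp
  show "norm A \<le> norm (complexify A)"
  proof (rule norm_blinfun_bound)
    fix x
    show "norm (A x) \<le> norm (complexify A) * norm x"
      using norm_blinfun[of "complexify A" "(x, 0)"] by (simp add: complexify_apply norm_prod_def)
  qed simp
qed

lemma clin_complexify: "complexification.clin (complexify A)"
  by (simp add: complexification.clin_def complexify_apply pair_scaleC_def blinfun.bilinear_simps)

lemma real_bch_radius:
  fixes As :: "('a::euclidean_space \<Rightarrow>\<^sub>L 'a) list"
  assumes "(\<Sum>A\<leftarrow>As. norm A) = pi"
  shows "op_conv_radius (bch_coeff scaleR As) > 1 \<and> summable (\<lambda>n. bch_coeff scaleR As (Suc n))"
proof -
  define Cs where "Cs = map complexify As"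
  have "(\<Sum>A\<leftarrow>Cs. norm A) = pi" by (simp add: Cs_def o_def norm_complexify assms)
  moreover have clin: "\<forall>C\<in>set Cs. complexification.clin C"
    by (auto simp: Cs_def clin_complexify)
  ultimately obtain \<mu> M \<rho> where \<mu>: "\<mu> 0 = 0" "1 < \<rho>" "\<forall>n. norm (\<mu> n) \<le> M / \<rho> ^ n"
    "\<forall>\<^sub>F t in nhds 0. (\<lambda>n. op_scale pair_scaleC (t ^ Suc n) (\<mu> (Suc n))) sums op_log (complexification.bch_prod Cs t)"
    by - (drule (1) complexification.bch_series, elim exE conjE)
  define \<iota> :: "'a \<Rightarrow>\<^sub>L ('a \<times> 'a)" where "\<iota> = Blinfun (\<lambda>x. (x, 0))"
  define \<pi> :: "('a \<times> 'a) \<Rightarrow>\<^sub>L 'a" where "\<pi> = Blinfun fst"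
  have \<iota>: "blinfun_apply \<iota> x = (x, 0)" for x
    unfolding \<iota>_def by (subst bounded_linear_Blinfun_apply) (auto intro!: bounded_linear_Pair bounded_linear_ident bounded_linear_zero)
  have \<pi>: "blinfun_apply \<pi> = fst"
    unfolding \<pi>_def by (intro bounded_linear_Blinfun_apply bounded_linear_fst)
  \<comment> \<open>The real coefficients are the compressions of the complex ones to the real part.
    Compression changes the geometric bound only by a constant factor.\<close>
  define \<nu> where "\<nu> n = \<pi> o\<^sub>L (\<mu> n o\<^sub>L \<iota>)" for n
  define F where "F t = op_prod (map (\<lambda>A. op_exp (op_scale scaleR t A)) As)" for t
  have scale: "op_scale scaleR t A = t *\<^sub>R A" for t and A :: "'a \<Rightarrow>\<^sub>L 'a"
    by (simp add: op_scale_def scaleR_blinfun_def)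
  have \<nu>_bound: "norm (\<nu> n) \<le> (norm \<pi> * M * norm \<iota>) / \<rho> ^ n" for n
  proof -
    have "norm (\<nu> n) \<le> norm \<pi> * (norm (\<mu> n) * norm \<iota>)"
      unfolding \<nu>_def by (intro order_trans[OF norm_blinfun_compose] mult_left_mono norm_blinfun_compose norm_ge_zero)
    also have "\<dots> \<le> norm \<pi> * (M / \<rho> ^ n * norm \<iota>)"
      by (intro mult_left_mono mult_right_mono spec[OF \<mu>(3)] norm_ge_zero)
    finally show ?thesis by simp
  qed
  have "filterlim complex_of_real (nhds 0) (nhds 0)"
    using tendsto_of_real[OF filterlim_ident[of "nhds 0"], where 'a = complex] by simp
  then have "\<forall>\<^sub>F t in nhds 0. (\<lambda>n. op_scale pair_scaleC (complex_of_real t ^ Suc n) (\<mu> (Suc n))) sums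
        op_log (complexification.bch_prod Cs (complex_of_real t))"
    and "\<forall>\<^sub>F t in nhds 0. norm (complexification.bch_prod Cs (complex_of_real t) - id_blinfun) \<le> 1 / 2"
    using \<mu>(4) complexification.bch_prod_near_id[of Cs] clin by (auto dest: eventually_compose_filterlim)
  then have series: "\<forall>\<^sub>F t in nhds 0. (\<lambda>n. op_scale scaleR (t ^ Suc n) (\<nu> (Suc n))) sums op_log (F t)"
  proof eventually_elim
    case (elim t)
    let ?F = "complexification.bch_prod Cs (complex_of_real t)"
    have "\<iota> (op_scale scaleR t A x) = op_scale pair_scaleC (complex_of_real t) (complexify A) (\<iota> x)" for A x
      by (simp add: scale \<iota> complexification.op_scale_apply complexify_apply
          complexification.scaleC_of_real blinfun.bilinear_simps)
    then have intertw: "\<iota> (F t x) = ?F (\<iota> x)" for x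
      unfolding F_def complexification.bch_prod_def Cs_def map_map o_def
      by (intro op_prod_intertwine op_exp_intertwine)
    have adm: "log_admissible ?F" using elim(2) by (intro log_admissible_near_id) simp
    \<comment> \<open>A kernel vector over the reals embeds as a kernel vector of the complexified
      segment, so admissibility descends to the real operator.\<close>
    have "op_segment l ?F (\<iota> x) = \<iota> (op_segment l (F t) x)" for l x
      by (simp add: op_segment_apply blinfun.bilinear_simps intertw)
    then have "log_admissible (F t)"
      using adm unfolding log_admissible_def op_injective_def by (metis \<iota> blinfun.zero_right prod.inject zero_prod_def)
    then have "\<iota> (op_log (F t) x) = op_log ?F (\<iota> x)" for x
      using adm intertw by (rule op_log_intertwine)
    then have "fst (op_log ?F (x, 0)) = op_log (F t) x" for x
      by (metis \<iota> fst_conv)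
    then have "\<pi> o\<^sub>L (op_log ?F o\<^sub>L \<iota>) = op_log (F t)"
      by (intro blinfun_eqI) (simp add: \<pi> \<iota>)
    moreover have "bounded_linear (\<lambda>T. \<pi> o\<^sub>L (T o\<^sub>L \<iota>))"
      by (intro bounded_linear_compose[OF bounded_bilinear.bounded_linear_right[OF bounded_bilinear_blinfun_compose]]
          bounded_bilinear.bounded_linear_left[OF bounded_bilinear_blinfun_compose])
    from bounded_linear.sums[OF this elim(1)]
    have "(\<lambda>n. \<pi> o\<^sub>L (op_scale pair_scaleC (complex_of_real t ^ Suc n) (\<mu> (Suc n)) o\<^sub>L \<iota>)) sums (\<pi> o\<^sub>L (op_log ?F o\<^sub>L \<iota>))" .
    moreover have "\<pi> o\<^sub>L (op_scale pair_scaleC (complex_of_real t ^ Suc n) (\<mu> (Suc n)) o\<^sub>L \<iota>) = op_scale scaleR (t ^ Suc n) (\<nu> (Suc n))" for n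
      by (intro blinfun_eqI)
        (simp add: \<pi> \<nu>_def scale complexification.op_scale_apply complexification.scaleC_of_real blinfun.bilinear_simps
          flip: of_real_power of_real_mult)
    ultimately show ?case by simp
  qed
  have \<nu>0: "\<nu> 0 = 0" by (intro blinfun_eqI) (simp add: \<nu>_def \<mu>(1))
  have "bch_coeff scaleR As = \<nu>"
    unfolding bch_coeff_def
  proof (rule the_equality)
    fix \<nu>' assume \<nu>': "\<nu>' 0 = 0 \<and> (\<forall>\<^sub>F t in nhds 0. (\<lambda>n. op_scale scaleR (t ^ Suc n) (\<nu>' (Suc n))) sums
      op_log (op_prod (map (\<lambda>A. op_exp (op_scale scaleR t A)) As)))"
    have "x = 0" if "\<And>e. e \<bullet> x = 0" for x :: 'a
      using that[of x] by simp
    then show "\<nu>' = \<nu>"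
      using \<nu>' series \<nu>0 unfolding F_def
      by (intro op_series_unique[where \<phi> = inner and smul = scaleR])
        (auto simp: scale blinfun.scaleR_left bounded_linear_inner_right)
  qed (use series \<nu>0 in \<open>simp add: F_def\<close>)
  then show ?thesis
    using op_conv_radius_gt_1[OF \<mu>(2) \<nu>_bound] geometric_bound_summable[OF \<mu>(2) \<nu>_bound] by simp
qed

lemma (in complex_hilbert_space) complex_bch_radius:
  assumes "\<forall>A\<in>set As. Vector_Spaces.linear scaleC scaleC (blinfun_apply A)" "(\<Sum>A\<leftarrow>As. norm A) = pi"
  shows "op_conv_radius (bch_coeff scaleC As) > 1 \<and> summable (\<lambda>n. bch_coeff scaleC As (Suc n))"
proof -
  have "\<forall>A\<in>set As. clin A"
    using assms(1) unfolding clin_def by (metis Vector_Spaces.linear_def module_hom.scale)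
  then obtain \<mu> M \<rho> where \<mu>: "\<mu> 0 = 0" "1 < \<rho>" "\<forall>n. norm (\<mu> n) \<le> M / \<rho> ^ n"
    "\<forall>\<^sub>F t in nhds 0. (\<lambda>n. op_scale scaleC (t ^ Suc n) (\<mu> (Suc n))) sums op_log (bch_prod As t)"
    using assms(2) by - (drule (1) bch_series, elim exE conjE)
  show ?thesis
    using op_conv_radius_gt_1[OF \<mu>(2) spec[OF \<mu>(3)]] geometric_bound_summable[OF \<mu>(2) spec[OF \<mu>(3)]]
    by (simp add: bch_coeff_eqI[OF \<mu>(1,4)])
qed

theorem theorem3p11:
  shows "(\<forall>As :: ('a::euclidean_space \<Rightarrow>\<^sub>L 'a) list.
            (\<Sum>A\<leftarrow>As. norm A) = pi \<longrightarrow>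
              op_conv_radius (bch_coeff (scaleR :: real \<Rightarrow> 'a \<Rightarrow> 'a) As) > 1 \<and>
              summable (\<lambda>n. bch_coeff (scaleR :: real \<Rightarrow> 'a \<Rightarrow> 'a) As (Suc n)))
       \<and> (\<forall>(scaleC :: complex \<Rightarrow> 'b::euclidean_space \<Rightarrow> 'b) cinner (As :: ('b \<Rightarrow>\<^sub>L 'b) list).
            complex_hilbert_space scaleC cinner \<longrightarrow>
            (\<forall>A\<in>set As. Vector_Spaces.linear scaleC scaleC (blinfun_apply A)) \<longrightarrow>
            (\<Sum>A\<leftarrow>As. norm A) = pi \<longrightarrow>
              op_conv_radius (bch_coeff scaleC As) > 1 \<and>
              summable (\<lambda>n. bch_coeff scaleC As (Suc n)))"
  using real_bch_radius complex_hilbert_space.complex_bch_radius by blast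

end
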